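(* Consider the Tangential Parabolic Target Following Method (TPTFM), described in the context, and denote $f_k=v^{(0)}_k$. Let $f_0\le\frac{\pi_*}{4\kappa}$. Then for every iteration $k\ge0$ at which the method performs a predictor step and $f_k<f_0$, $$f_{k+1}\le\frac1r\left\{\frac{\beta_k}{1-\beta_k}+\frac{5(n+1)f_k}{f_0-f_k}\right\}f_k .$$
   Context: Problem. Let $A\in\mathbb{R}^{m\times n}$, $b\in\mathbb{R}^m$, $c\in\mathbb{R}^n$. The primal-dual pair is $\min\{\langle c,x\rangle: Ax=b,\ x\ge 0\}=\max\{\langle b,y\rangle: s+A^Ty=c,\ s\ge 0\}$. Let $\mathcal F_0=\{u=(x,s,y): Ax=b,\ s+A^Ty=c,\ x>0,\ s>0\}$, assumed nonempty. Non-degeneracy assumption: there is a unique primal solution $x^*$, with exactly $m$ positive components, which are the first $m$: $x^*=(x^*_B,0)$, $x^*_B>0$. In the partition $A=(A_B,A_N)$ the matrix $A_B\in\mathbb{R}^{m\times m}$ is non-degenerate. With $y^*=A_B^{-T}c_B$, $s_B^*=0$, it is assumed that $s^*_N=c_N-A_N^Ty^*>0$. Denote $x^*_{\min}=\min_{1\le i\le m}(x^* )^{(i)}$, $s^*_{\min}=\min_{m+1\le i\le n}(s^* )^{(i)}$, $\pi_*=x^*_{\min}s^*_{\min}$, $\kappa=\|A_B^{-1}A_N\|_\infty$ with $\|C\|_\infty=\max_{i,j}|C^{(i,j)}|$ for matrices. Notation. Products, powers and square roots of vectors are componentwise; $\|\cdot\|$ is the Euclidean norm; $\check e\in\mathbb{R}^n$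 is the vector of ones. Control variables: $w=(v^{(0)},v)\in\mathcal F_p=\{(v^{(0)},v)\in\mathbb{R}_+\times\mathbb{R}^n: v^{(0)}>\|v\|^2\}$, $\rho(w)=\frac{v^{(0)}-\|v\|^2}{n+1}$. For $z=(u,w)$, $u=(x,s,y)$, the residual $r(z)\in\mathbb{R}^{n+1}$ has components $r^{(0)}(z)=v^{(0)}-\langle s,x\rangle$, $r^{(i)}(z)=x^{(i)}s^{(i)}-(v^{(i)})^2$ for $1\le i\le n$; $\check r(z)\in\mathbb{R}^n$ consists of components $1,\dots,n$. Let $\mathcal F=\{(u,w): u\in\mathcal F_0, w\in\mathcal F_p, r(z)\ge0\}$; its interior is given by $r(z)>0$. On the interior, $F(z)=-\sum_{i=0}^n\ln r^{(i)}(z)$ and $\Psi(z)=F(z)+(n+1)\ln\rho(w)\ge0$ is the functional proximity measure. For $k=0,1,2$ let $\chi_k(z)=\Big[\sum_{i=0}^n\frac{(r^{(i)}(z)-\rho(w))^2}{[r^{(i)}(z)]^k[\rho(w)]^{2-k}}\Big]^{1/2}$ and $\delta(z)=\chi_1^2(z)/\chi_2(z)$ ($\delta(z)=0$ if $\chi_2(z)=0$). For $u_k=(x_k,s_k,y_k)\in\mathcal F_0$ with $X_k=\mathrm{Diag}(x_k)$, $S_k=\mathrm{Diag}(s_k)$ and $d\in\mathbb{R}^n$, $\Delta_k(d)=(\Delta^x,\Delta^s,\Delta^y)$ is the unique solution of $X_k\Delta^s+S_k\Delta^x=d$, $A\Delta^x=0$, $\Delta^s+A^T\Delta^y=0$.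 Let $\omega_*(\tau)=-\tau-\ln(1-\tau)$, $0\le\tau<1$. Method TPTFM. Choose $r\in(0,1)$, $A_\psi=\omega_*(r)$, $\beta=\frac{r}{2+r}$, $u_0=(x_0,s_0,y_0)\in\mathcal F_0$. With $\sigma=\min_i x_0^{(i)}s_0^{(i)}$, set $w_0=(v_0^{(0)},v_0)$ where $v_0^{(0)}=\langle s_0,x_0\rangle+\sigma$, $v_0^{(i)}=\sqrt{x_0^{(i)}s_0^{(i)}-\sigma}$. At iteration $k\ge 0$, with $z_k=(u_k,w_k)$ and $w_k=(v_k^{(0)},v_k)$, choose an acceptance level $\beta_k\in[0,\beta)$. Predictor step (performed if $\delta(z_k)\le\beta_k$): set $d_k=\big(\frac{\|v_k\|^2}{n+1}-\rho(w_k)\big)\check e-2v_k^2$, $\Delta_k=\Delta_k(d_k)$, take $\alpha_k\in(0,1)$ a solution of the equation $\Psi(u_k+\alpha\Delta_k,(1-\alpha)w_k)=A_\psi$ (with the point in the interior of $\mathcal F$), and set $u_{k+1}=u_k+\alpha_k\Delta_k$, $w_{k+1}=(1-\alpha_k)w_k$. Corrector step (otherwise): set $d_k=\rho(w_k)\check e-\check r(z_k)$, $\Delta_k=\Delta_k(d_k)$, take $\alpha_k\ge0$ an approximate minimizer of $F(u_k+\alpha\Delta_k,w_k)$ over $\alpha\ge0$, and set $u_{k+1}=u_k+\alpha_k\Delta_k$, $w_{k+1}=w_k$. Stop if $v_k^{(0)}\le\epsilon$ and $\delta(z_k)\le\beta_k$. *)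

theory Defs
  imports "HOL-Analysis.Analysis"
begin

section \<open>The primal-dual pair\<close>

definition primal_feasible :: "real^'n^'m \<Rightarrow> real^'m \<Rightarrow> (real^'n) set" where
  "primal_feasible A b = {x. A *v x = b \<and> (\<forall>i. 0 \<le> x $ i)}"

definition primal_solutions :: "real^'n^'m \<Rightarrow> real^'m \<Rightarrow> real^'n \<Rightarrow> (real^'n) set" where
  "primal_solutions A b c =
     {x \<in> primal_feasible A b. \<forall>x' \<in> primal_feasible A b. c \<bullet> x \<le> c \<bullet> x'}"

text \<open>Primal-dual points are triples \<open>u = (x, s, y)\<close>.\<close>

type_synonym ('n, 'm) pd_point = "(real^'n) \<times> (real^'n) \<times> (real^'m)"

definition strictly_feasible ::
    "real^'n^'m \<Rightarrow> real^'m \<Rightarrow> real^'n \<Rightarrow> ('n::finite, 'm::finite) pd_point set" where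
  "strictly_feasible A b c =
     {(x, s, y). A *v x = b \<and> s + transpose A *v y = c \<and> (\<forall>i. 0 < x $ i) \<and> (\<forall>i. 0 < s $ i)}"

section \<open>Non-degenerate problems\<close>

text \<open>
  The \<open>n\<close> columns are indexed by the sum type \<open>'m + 'k\<close>: the first \<open>m\<close> (basic) indices are
  the \<open>Inl j\<close>, the remaining \<open>n - m\<close> (non-basic) ones the \<open>Inr j\<close>. Types being nonempty,
  \<open>n > m\<close>, as is needed for \<open>s_min\<close> and \<open>kappa\<close> below to make sense.
\<close>

definition basic_cols :: "real^('m::finite + 'k::finite)^'m \<Rightarrow> real^'m^'m" where
  "basic_cols A = (\<chi> i j. A $ i $ Inl j)"

definition nonbasic_cols :: "real^('m::finite + 'k::finite)^'m \<Rightarrow> real^'k^'m" where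
  "nonbasic_cols A = (\<chi> i j. A $ i $ Inr j)"

definition basic_part :: "real^('m::finite + 'k::finite) \<Rightarrow> real^'m" where
  "basic_part x = (\<chi> j. x $ Inl j)"

definition nonbasic_part :: "real^('m::finite + 'k::finite) \<Rightarrow> real^'k" where
  "nonbasic_part x = (\<chi> j. x $ Inr j)"

definition dual_y :: "real^('m::finite + 'k::finite)^'m \<Rightarrow> real^('m + 'k) \<Rightarrow> real^'m" where
  "dual_y A c = matrix_inv (transpose (basic_cols A)) *v basic_part c"

definition dual_s :: "real^('m::finite + 'k::finite)^'m \<Rightarrow> real^('m + 'k) \<Rightarrow> real^('m + 'k)" where
  "dual_s A c = (\<chi> i. case i of Inl j \<Rightarrow> 0
     | Inr j \<Rightarrow> (nonbasic_part c - transpose (nonbasic_cols A) *v dual_y A c) $ j)"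

definition nondegenerate ::
    "real^('m::finite + 'k::finite)^'m \<Rightarrow> real^'m \<Rightarrow> real^('m + 'k) \<Rightarrow> real^('m + 'k) \<Rightarrow> bool" where
  "nondegenerate A b c xs \<longleftrightarrow>
     primal_solutions A b c = {xs} \<and>
     (\<forall>j. 0 < xs $ Inl j) \<and> (\<forall>j. xs $ Inr j = 0) \<and>
     invertible (basic_cols A) \<and>
     (\<forall>j. 0 < dual_s A c $ Inr j)"

definition x_min :: "real^('m::finite + 'k::finite) \<Rightarrow> real" where
  "x_min xs = Min (range (\<lambda>j. xs $ Inl j))"

definition s_min :: "real^('m::finite + 'k::finite)^'m \<Rightarrow> real^('m + 'k) \<Rightarrow> real" where
  "s_min A c = Min (range (\<lambda>j. dual_s A c $ Inr j))"

definition pi_star :: "real^('m::finite + 'k::finite)^'m \<Rightarrow> real^('m + 'k) \<Rightarrow> real^('m + 'k) \<Rightarrow> real" where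
  "pi_star A c xs = x_min xs * s_min A c"

definition max_entry_norm :: "real^'n^'m \<Rightarrow> real" where
  "max_entry_norm C = Max (range (\<lambda>(i, j). \<bar>C $ i $ j\<bar>))"

definition kappa :: "real^('m::finite + 'k::finite)^'m \<Rightarrow> real" where
  "kappa A = max_entry_norm (matrix_inv (basic_cols A) ** nonbasic_cols A)"

section \<open>The parabolic target space\<close>

text \<open>Controls are pairs \<open>w = (v0, v)\<close>.\<close>

type_synonym 'n control = "real \<times> (real^'n)"

definition controls :: "'n::finite control set" where
  "controls = {(v0, v). 0 \<le> v0 \<and> (norm v)\<^sup>2 < v0}"

definition rho :: "'n::finite control \<Rightarrow> real" where
  "rho w = (fst w - (norm (snd w))\<^sup>2) / (real CARD('n) + 1)"

text \<open>The \<open>n + 1\<close> residuals are indexed by \<open>'n option\<close>, component \<open>0\<close> being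
  \<open>None\<close>.\<close>

definition resid :: "('n::finite, 'm::finite) pd_point \<times> 'n control \<Rightarrow> real^('n option)" where
  "resid z = (case z of ((x, s, y), (v0, v)) \<Rightarrow>
     (\<chi> j. case j of None \<Rightarrow> v0 - s \<bullet> x | Some i \<Rightarrow> x $ i * s $ i - (v $ i)\<^sup>2))"

definition target_region ::
    "real^'n^'m \<Rightarrow> real^'m \<Rightarrow> real^'n \<Rightarrow> (('n::finite, 'm::finite) pd_point \<times> 'n control) set" where
  "target_region A b c =
     {z \<in> strictly_feasible A b c \<times> controls. \<forall>j. 0 \<le> resid z $ j}"

definition target_interior ::
    "real^'n^'m \<Rightarrow> real^'m \<Rightarrow> real^'n \<Rightarrow> (('n::finite, 'm::finite) pd_point \<times> 'n control) set" where
  "target_interior A b c = {z \<in> target_region A b c. \<forall>j. 0 < resid z $ j}"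

definition barrier :: "('n::finite, 'm::finite) pd_point \<times> 'n control \<Rightarrow> real" where
  "barrier z = - (\<Sum>j\<in>UNIV. ln (resid z $ j))"

definition proximity :: "('n::finite, 'm::finite) pd_point \<times> 'n control \<Rightarrow> real" where
  "proximity z = barrier z + (real CARD('n) + 1) * ln (rho (snd z))"

text \<open>Only used for \<open>k \<le> 2\<close>, where the subtraction \<open>2 - k\<close> does not truncate.\<close>

definition chi_measure :: "nat \<Rightarrow> ('n::finite, 'm::finite) pd_point \<times> 'n control \<Rightarrow> real" where
  "chi_measure k z = sqrt (\<Sum>j\<in>UNIV. (resid z $ j - rho (snd z))\<^sup>2 /
     ((resid z $ j) ^ k * (rho (snd z)) ^ (2 - k)))"

definition delta_measure :: "('n::finite, 'm::finite) pd_point \<times> 'n control \<Rightarrow> real" where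
  "delta_measure z =
     (if chi_measure 2 z = 0 then 0 else (chi_measure 1 z)\<^sup>2 / chi_measure 2 z)"

definition omega_star :: "real \<Rightarrow> real" where
  "omega_star \<tau> = - \<tau> - ln (1 - \<tau>)"

section \<open>The method\<close>

definition newton_direction ::
    "real^'n^'m \<Rightarrow> ('n::finite, 'm::finite) pd_point \<Rightarrow> real^'n \<Rightarrow> ('n, 'm) pd_point \<Rightarrow> bool" where
  "newton_direction A u d D \<longleftrightarrow> (case u of (x, s, y) \<Rightarrow> case D of (dx, ds, dy) \<Rightarrow>
     (\<forall>i. x $ i * ds $ i + s $ i * dx $ i = d $ i) \<and>
     A *v dx = 0 \<and> ds + transpose A *v dy = 0)"

definition initial_control :: "('n::finite, 'm::finite) pd_point \<Rightarrow> 'n control" where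
  "initial_control u = (case u of (x, s, y) \<Rightarrow>
     let \<sigma> = Min (range (\<lambda>i. x $ i * s $ i))
     in (s \<bullet> x + \<sigma>, \<chi> i. sqrt (x $ i * s $ i - \<sigma>)))"

definition predictor_rhs :: "'n::finite control \<Rightarrow> real^'n" where
  "predictor_rhs w = (\<chi> i.
     (norm (snd w))\<^sup>2 / (real CARD('n) + 1) - rho w - 2 * (snd w $ i)\<^sup>2)"

definition corrector_rhs :: "('n::finite, 'm::finite) pd_point \<times> 'n control \<Rightarrow> real^'n" where
  "corrector_rhs z = (\<chi> i. rho (snd z) - resid z $ Some i)"

definition predictor_step ::
    "real^'n^'m \<Rightarrow> real^'m \<Rightarrow> real^'n \<Rightarrow> real \<Rightarrow>
     ('n::finite, 'm::finite) pd_point \<times> 'n control \<Rightarrow> ('n, 'm) pd_point \<times> 'n control \<Rightarrow> bool" where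
  "predictor_step A b c r z z' \<longleftrightarrow> (\<exists>\<alpha> D.
     newton_direction A (fst z) (predictor_rhs (snd z)) D \<and>
     0 < \<alpha> \<and> \<alpha> < 1 \<and>
     z' = (fst z + \<alpha> *\<^sub>R D, (1 - \<alpha>) *\<^sub>R snd z) \<and>
     z' \<in> target_interior A b c \<and>
     proximity z' = omega_star r)"

text \<open>
  The step length of the corrector minimizes the barrier, up to an additive tolerance \<open>\<eta>\<close>, over
  those \<open>\<alpha> \<ge> 0\<close> for which the point stays in the domain of the barrier.
\<close>

definition corrector_step ::
    "real^'n^'m \<Rightarrow> real^'m \<Rightarrow> real^'n \<Rightarrow> real \<Rightarrow>
     ('n::finite, 'm::finite) pd_point \<times> 'n control \<Rightarrow> ('n, 'm) pd_point \<times> 'n control \<Rightarrow> bool" where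
  "corrector_step A b c \<eta> z z' \<longleftrightarrow> (\<exists>\<alpha> D.
     newton_direction A (fst z) (corrector_rhs z) D \<and>
     0 \<le> \<alpha> \<and>
     z' = (fst z + \<alpha> *\<^sub>R D, snd z) \<and>
     z' \<in> target_interior A b c \<and>
     (\<forall>\<alpha>' \<ge> 0. (fst z + \<alpha>' *\<^sub>R D, snd z) \<in> target_interior A b c \<longrightarrow>
        barrier z' \<le> barrier (fst z + \<alpha>' *\<^sub>R D, snd z) + \<eta>))"

definition stops :: "real \<Rightarrow> (nat \<Rightarrow> real) \<Rightarrow>
     (nat \<Rightarrow> ('n::finite, 'm::finite) pd_point \<times> 'n control) \<Rightarrow> nat \<Rightarrow> bool" where
  "stops \<epsilon> \<beta> z k \<longleftrightarrow> fst (snd (z k)) \<le> \<epsilon> \<and> delta_measure (z k) \<le> \<beta> k"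

text \<open>The step from \<open>z k\<close> to \<open>z (Suc k)\<close> is carried out; the values of \<open>z\<close> after the method has
  stopped are irrelevant.\<close>

definition performed :: "real \<Rightarrow> (nat \<Rightarrow> real) \<Rightarrow>
     (nat \<Rightarrow> ('n::finite, 'm::finite) pd_point \<times> 'n control) \<Rightarrow> nat \<Rightarrow> bool" where
  "performed \<epsilon> \<beta> z k \<longleftrightarrow> (\<forall>j\<le>k. \<not> stops \<epsilon> \<beta> z j)"

text \<open>A run with parameter \<open>r\<close>, accuracy \<open>\<epsilon>\<close>, acceptance levels \<open>\<beta> k\<close> and tolerances \<open>\<eta> k\<close> of the
  approximate minimization in the corrector steps.\<close>

definition TPTFM_run ::
    "real^'n^'m \<Rightarrow> real^'m \<Rightarrow> real^'n \<Rightarrow> real \<Rightarrow> real \<Rightarrow> (nat \<Rightarrow> real) \<Rightarrow> (nat \<Rightarrow> real) \<Rightarrow>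
     (nat \<Rightarrow> ('n::finite, 'm::finite) pd_point \<times> 'n control) \<Rightarrow> bool" where
  "TPTFM_run A b c r \<epsilon> \<beta> \<eta> z \<longleftrightarrow>
     0 < r \<and> r < 1 \<and>
     (\<forall>k. 0 \<le> \<beta> k \<and> \<beta> k < r / (2 + r)) \<and>
     (\<forall>k. 0 \<le> \<eta> k) \<and>
     fst (z 0) \<in> strictly_feasible A b c \<and>
     snd (z 0) = initial_control (fst (z 0)) \<and>
     (\<forall>k. performed \<epsilon> \<beta> z k \<longrightarrow>
        (if delta_measure (z k) \<le> \<beta> k
         then predictor_step A b c r (z k) (z (Suc k))
         else corrector_step A b c (\<eta> k) (z k) (z (Suc k))))"

end

theory Submission
  imports Defs
begin

text \<open>
  Write \<open>z = ((x, s, y), w)\<close> for the point at which the predictor step starts, \<open>w = (f, v)\<close>, and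
  \<open>z'\<close> for the point it leads to, so that \<open>w' = (1 - \<alpha>) w\<close>. Let \<open>D z\<close> be the vector of the
  \<open>n + 1\<close> deviations \<open>r\<^sup>(\<^sup>j\<^sup>)(z) - \<rho>(w)\<close>. The right-hand side of the predictor makes the deviations
  constant to first order along the step: \<open>D z' = D z + \<alpha>\<^sup>2 g\<close>, where \<open>g\<close> consists of the products
  \<open>\<Delta>x \<Delta>s\<close> and of the deviations of the squares \<open>v\<^sup>2\<close> from their mean over \<open>n + 1\<close> indices
  (\<open>predictor_deviation\<close>).

  The step ends where \<open>\<Psi>(z') = \<omega>\<^sub>*(r)\<close>, which forces \<open>\<parallel>D z'\<parallel> \<ge> r \<rho>(w')\<close>
  (\<open>deviation_ge_of_proximity\<close>), and \<open>\<rho>(w') \<ge> (1 - \<alpha>) \<rho>(w)\<close> by concavity. The acceptance test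
  \<open>\<delta>(z) \<le> \<beta>\<close> gives \<open>\<parallel>D z\<parallel> \<le> \<beta> / (1 - \<beta>) \<rho>(w)\<close> (\<open>deviation_le_of_delta\<close>). Hence
  \<open>r (1 - \<alpha>) \<le> \<beta> / (1 - \<beta>) + \<parallel>g\<parallel> / \<rho>(w)\<close>, and it remains to bound the last term.

  All controls of a run are multiples \<open>t w\<^sub>0\<close> of the initial one (\<open>run_invariant\<close>), where
  \<open>f = t f\<^sub>0\<close>. As \<open>\<parallel>v\<^sub>0\<parallel>\<^sup>2 < f\<^sub>0\<close>, this gives \<open>\<parallel>v\<parallel>\<^sup>2 \<le> f\<^sup>2 / f\<^sub>0\<close> and
  \<open>(n + 1) \<rho>(w) \<ge> f (f\<^sub>0 - f) / f\<^sub>0\<close>. So \<open>\<parallel>g\<parallel> \<le> 5 f\<^sup>2 / f\<^sub>0\<close> suffices, and since the squares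
  \<open>v\<^sup>2\<close> contribute at most \<open>f\<^sup>2 / f\<^sub>0\<close>, one needs \<open>\<parallel>\<Delta>x \<Delta>s\<parallel> \<le> 4 f\<^sup>2 / f\<^sub>0\<close>. Here non-degeneracy enters.
  Since \<open>\<langle>s, x\<rangle> \<le> f\<close> and \<open>4 \<kappa> f \<le> \<pi>\<^sub>*\<close>, the coordinates \<open>x\<^sub>B\<close> and \<open>s\<^sub>N\<close> are at least \<open>3/4\<close> of their
  optimal values (\<open>near_solution\<close>). The relations
  \<open>\<Delta>x\<^sub>B = - K \<Delta>x\<^sub>N\<close> and \<open>\<Delta>s\<^sub>N = K\<^sup>T \<Delta>s\<^sub>B\<close> with \<open>K = A\<^sub>B\<^sup>-\<^sup>1 A\<^sub>N\<close> then bound the Newton direction by its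
  right-hand side \<open>d\<close> (\<open>newton_products_bound\<close>), namely
  \<open>\<pi>\<^sub>* \<parallel>\<Delta>x \<Delta>s\<parallel> \<le> \<surd>2 \<kappa> \<parallel>d\<parallel>\<^sub>1\<^sup>2\<close>, and \<open>\<parallel>d\<parallel>\<^sub>1 \<le> 3 f\<close>.
\<close>

section \<open>Finite sums\<close>

lemma sum_UNIV_Plus:
  fixes g :: "'a::finite + 'b::finite \<Rightarrow> real"
  shows "(\<Sum>i\<in>UNIV. g i) = (\<Sum>j\<in>UNIV. g (Inl j)) + (\<Sum>j\<in>UNIV. g (Inr j))"
  using sum.Plus[of "UNIV::'a set" "UNIV::'b set" g] by (simp add: comp_def)

lemma sum_UNIV_option:
  fixes g :: "'a::finite option \<Rightarrow> real"
  shows "(\<Sum>j\<in>UNIV. g j) = g None + (\<Sum>i\<in>UNIV. g (Some i))"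
  by (simp add: UNIV_option_conv sum.reindex)

lemma norm_squared_eq_sum:
  fixes x :: "real^'a::finite"
  shows "(norm x)\<^sup>2 = (\<Sum>i\<in>UNIV. (x $ i)\<^sup>2)"
  unfolding power2_norm_eq_inner inner_vec_def by (simp add: power2_eq_square)

section \<open>Basic and nonbasic coordinates\<close>

text \<open>The matrix \<open>K = A\<^sub>B\<^sup>-\<^sup>1 A\<^sub>N\<close>, whose largest absolute entry is \<open>\<kappa>\<close>. The kernel of \<open>A\<close> is the graph
  of \<open>- K\<close> over the nonbasic coordinates, and its orthogonal complement, the range of \<open>A\<^sup>T\<close>, is the
  graph of \<open>K\<^sup>T\<close> over the basic ones.\<close>

definition basis_ratio :: "real^('m::finite + 'k::finite)^'m \<Rightarrow> real^'k^'m" where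
  "basis_ratio A = matrix_inv (basic_cols A) ** nonbasic_cols A"

lemma matrix_inv_right_left:
  fixes M :: "real^'a::finite^'a"
  assumes "invertible M"
  shows "M ** matrix_inv M = mat 1" and "matrix_inv M ** M = mat 1"
  using someI_ex[OF assms[unfolded invertible_def]] by (auto simp: matrix_inv_def)

lemma basic_mult_basis_ratio:
  assumes "invertible (basic_cols A)"
  shows "basic_cols A ** basis_ratio A = nonbasic_cols A"
  using matrix_inv_right_left(1)[OF assms] by (simp add: basis_ratio_def matrix_mul_assoc)

lemma abs_basis_ratio_le_kappa: "\<bar>basis_ratio A $ i $ j\<bar> \<le> kappa A"
  unfolding kappa_def max_entry_norm_def basis_ratio_def[symmetric]
  by (rule Max_ge) (auto intro!: rev_image_eqI[where x="(i, j)"])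

lemma mult_vec_split:
  "A *v x = basic_cols A *v basic_part x + nonbasic_cols A *v nonbasic_part x"
  by (simp add: vec_eq_iff matrix_vector_mult_def sum_UNIV_Plus basic_cols_def nonbasic_cols_def
      basic_part_def nonbasic_part_def)

lemma transpose_mult_vec_Inl: "(transpose A *v y) $ Inl i = (transpose (basic_cols A) *v y) $ i"
  by (simp add: matrix_vector_mult_def basic_cols_def transpose_def)

lemma transpose_mult_vec_Inr: "(transpose A *v y) $ Inr j = (transpose (nonbasic_cols A) *v y) $ j"
  by (simp add: matrix_vector_mult_def nonbasic_cols_def transpose_def)

lemma kernel_basic_coordinate:
  assumes inv: "invertible (basic_cols A)" and ker: "A *v x = 0"
  shows "x $ Inl i = - (\<Sum>j\<in>UNIV. basis_ratio A $ i $ j * x $ Inr j)"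
proof -
  have "matrix_inv (basic_cols A) *v (A *v x) = basic_part x + basis_ratio A *v nonbasic_part x"
    unfolding mult_vec_split[of A x] matrix_vector_right_distrib matrix_vector_mul_assoc
    by (simp add: matrix_inv_right_left(2)[OF inv] basis_ratio_def)
  then have "basic_part x + basis_ratio A *v nonbasic_part x = 0"
    by (simp add: ker)
  then have "(basic_part x + basis_ratio A *v nonbasic_part x) $ i = 0"
    by simp
  then show ?thesis
    by (simp add: basic_part_def nonbasic_part_def matrix_vector_mult_def)
qed

lemma range_nonbasic_coordinate:
  assumes inv: "invertible (basic_cols A)" and ran: "s + transpose A *v y = 0"
  shows "s $ Inr j = (\<Sum>i\<in>UNIV. basis_ratio A $ i $ j * s $ Inl i)"
proof -
  have coord: "s $ i = - (transpose A *v y) $ i" for i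
    using ran by (metis add_eq_0_iff2 vector_uminus_component)
  have mult: "(transpose (basis_ratio A) *v u) $ j = (\<Sum>i\<in>UNIV. basis_ratio A $ i $ j * u $ i)" for u
    by (simp add: matrix_vector_mult_def transpose_def del: transpose_matrix_vector)
  have "transpose (nonbasic_cols A) *v y =
      transpose (basis_ratio A) *v (transpose (basic_cols A) *v y)"
    by (simp only: matrix_vector_mul_assoc matrix_transpose_mul[symmetric]
        basic_mult_basis_ratio[OF inv])
  then show ?thesis
    unfolding coord transpose_mult_vec_Inl transpose_mult_vec_Inr
    by (simp add: mult sum_negf del: transpose_matrix_vector)
qed

lemma kernel_orthogonal_range:
  fixes A :: "real^'n::finite^'m::finite"
  assumes "A *v x = 0" and "s + transpose A *v y = 0"
  shows "s \<bullet> x = 0"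
proof -
  have "s = - (transpose A *v y)"
    using assms(2) by (simp add: add_eq_0_iff2)
  then have "s \<bullet> x = - (y \<bullet> (A *v x))"
    by (simp add: dot_lmul_matrix[symmetric])
  then show ?thesis using assms(1) by simp
qed

lemma dual_solution_equation:
  assumes "invertible (basic_cols A)"
  shows "dual_s A c + transpose A *v dual_y A c = c"
proof -
  have "transpose (basic_cols A) *v dual_y A c = basic_part c"
    using matrix_inv_right_left(1)[OF transpose_invertible[OF assms]]
    by (simp add: dual_y_def matrix_vector_mul_assoc del: transpose_matrix_vector)
  then have "(dual_s A c + transpose A *v dual_y A c) $ i = c $ i" for i
    by (cases i) (simp_all add: transpose_mult_vec_Inl transpose_mult_vec_Inr dual_s_def
        basic_part_def nonbasic_part_def del: transpose_matrix_vector)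
  then show ?thesis by (simp add: vec_eq_iff del: transpose_matrix_vector)
qed

lemma pi_star_positive_bounds:
  assumes "nondegenerate A b c xs"
  shows "0 < x_min xs" and "0 < s_min A c" and "x_min xs \<le> xs $ Inl i"
    and "s_min A c \<le> dual_s A c $ Inr j"
proof -
  show "0 < x_min xs" "0 < s_min A c"
    using assms by (auto simp: x_min_def s_min_def nondegenerate_def)
  show "x_min xs \<le> xs $ Inl i" "s_min A c \<le> dual_s A c $ Inr j"
    by (simp_all add: x_min_def s_min_def)
qed

section \<open>Size of the Newton direction\<close>

text \<open>The index \<open>B\<close> marks basic and \<open>N\<close> nonbasic coordinates; \<open>XB\<close> and \<open>SN\<close> are the optimal values of
  \<open>x\<^sub>B\<close> and \<open>s\<^sub>N\<close>. The relations \<open>ker\<close> and \<open>ran\<close> control \<open>\<Delta>x\<^sub>B\<close> and \<open>\<Delta>s\<^sub>N\<close>, multiplied by the small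
  quantities \<open>s\<^sub>B\<close> and \<open>x\<^sub>N\<close> in the Newton equations, by the weighted norms \<open>P\<close> of \<open>\<Delta>x\<^sub>N\<close> and \<open>Q\<close> of
  \<open>\<Delta>s\<^sub>B\<close>. These terms are absorbed, which leaves \<open>P + Q \<le> 2 D\<close>, and the sums of
  the absolute products \<open>\<Delta>x \<Delta>s\<close>, multiplied by \<open>xm sm\<close>, are at most \<open>\<kappa> P Q\<close>.\<close>

lemma newton_products_bound:
  fixes K :: "'m::finite \<Rightarrow> 'k::finite \<Rightarrow> real"
    and xB sB dxB dsB dB XB :: "'m \<Rightarrow> real" and xN sN dxN dsN dN SN :: "'k \<Rightarrow> real"
  assumes K: "\<And>i j. \<bar>K i j\<bar> \<le> \<kappa>"
    and xm: "0 < xm" "\<And>i. xm \<le> XB i" and sm: "0 < sm" "\<And>j. sm \<le> SN j"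
    and pos: "\<And>i. 0 < sB i" "\<And>j. 0 < xN j"
    and gap: "(\<Sum>j\<in>UNIV. SN j * xN j) + (\<Sum>i\<in>UNIV. XB i * sB i) \<le> f"
    and small: "4 * \<kappa> * f \<le> xm * sm"
    and near: "\<And>i. 3 / 4 * XB i \<le> xB i" "\<And>j. 3 / 4 * SN j \<le> sN j"
    and ker: "\<And>i. dxB i = - (\<Sum>j\<in>UNIV. K i j * dxN j)"
    and ran: "\<And>j. dsN j = (\<Sum>i\<in>UNIV. K i j * dsB i)"
    and eqB: "\<And>i. xB i * dsB i + sB i * dxB i = dB i"
    and eqN: "\<And>j. xN j * dsN j + sN j * dxN j = dN j"
  defines "D \<equiv> (\<Sum>i\<in>UNIV. \<bar>dB i\<bar>) + (\<Sum>j\<in>UNIV. \<bar>dN j\<bar>)"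
  shows "xm * sm * (\<Sum>i\<in>UNIV. \<bar>dxB i * dsB i\<bar>) \<le> \<kappa> * D\<^sup>2"
    and "xm * sm * (\<Sum>j\<in>UNIV. \<bar>dxN j * dsN j\<bar>) \<le> \<kappa> * D\<^sup>2"
proof -
  define P where "P = (\<Sum>j\<in>UNIV. SN j * \<bar>dxN j\<bar>)"
  define Q where "Q = (\<Sum>i\<in>UNIV. XB i * \<bar>dsB i\<bar>)"
  define X where "X = (\<Sum>j\<in>UNIV. SN j * xN j)"
  define Y where "Y = (\<Sum>i\<in>UNIV. XB i * sB i)"
  have SN: "0 < SN j" for j using sm order_less_le_trans by blast
  have XB: "0 < XB i" for i using xm order_less_le_trans by blast
  have nn: "0 \<le> P" "0 \<le> Q" "0 \<le> X" "0 \<le> Y"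
    unfolding P_def Q_def X_def Y_def
    by (auto intro!: sum_nonneg mult_nonneg_nonneg less_imp_le[OF SN] less_imp_le[OF XB]
        less_imp_le[OF pos(1)] less_imp_le[OF pos(2)])
  have \<kappa>0: "0 \<le> \<kappa>" using K order_trans abs_ge_zero by blast
  have XY: "X + Y \<le> f" using gap by (simp add: X_def Y_def)
  have dxB: "sm * \<bar>dxB i\<bar> \<le> \<kappa> * P" for i
  proof -
    have "sm * \<bar>dxB i\<bar> \<le> sm * (\<Sum>j\<in>UNIV. \<kappa> * \<bar>dxN j\<bar>)"
      unfolding ker using sm(1) K
      by (auto simp: abs_mult intro!: mult_left_mono order_trans[OF sum_abs] sum_mono mult_right_mono)
    also have "\<dots> = \<kappa> * (\<Sum>j\<in>UNIV. sm * \<bar>dxN j\<bar>)"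
      by (simp add: sum_distrib_left mult_ac)
    also have "\<dots> \<le> \<kappa> * P"
      unfolding P_def using sm \<kappa>0 by (intro mult_left_mono sum_mono mult_right_mono) auto
    finally show ?thesis .
  qed
  have dsN: "xm * \<bar>dsN j\<bar> \<le> \<kappa> * Q" for j
  proof -
    have "xm * \<bar>dsN j\<bar> \<le> xm * (\<Sum>i\<in>UNIV. \<kappa> * \<bar>dsB i\<bar>)"
      unfolding ran using xm(1) K
      by (auto simp: abs_mult intro!: mult_left_mono order_trans[OF sum_abs] sum_mono mult_right_mono)
    also have "\<dots> = \<kappa> * (\<Sum>i\<in>UNIV. xm * \<bar>dsB i\<bar>)"
      by (simp add: sum_distrib_left mult_ac)
    also have "\<dots> \<le> \<kappa> * Q"
      unfolding Q_def using xm \<kappa>0 by (intro mult_left_mono sum_mono mult_right_mono) auto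
    finally show ?thesis .
  qed
  have crossN: "xm * sm * (\<Sum>j\<in>UNIV. g j * \<bar>dsN j\<bar>) \<le> (\<kappa> * Q) * (\<Sum>j\<in>UNIV. SN j * g j)"
    if "\<And>j. 0 \<le> g j" for g
    unfolding sum_distrib_left
  proof (rule sum_mono)
    fix j
    have "(sm * g j) * (xm * \<bar>dsN j\<bar>) \<le> (SN j * g j) * (\<kappa> * Q)"
      using sm that xm(1) SN by (intro mult_mono mult_right_mono dsN) (auto simp: less_imp_le)
    then show "xm * sm * (g j * \<bar>dsN j\<bar>) \<le> (\<kappa> * Q) * (SN j * g j)" by (simp add: mult_ac)
  qed
  have crossB: "xm * sm * (\<Sum>i\<in>UNIV. g i * \<bar>dxB i\<bar>) \<le> (\<kappa> * P) * (\<Sum>i\<in>UNIV. XB i * g i)"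
    if "\<And>i. 0 \<le> g i" for g
    unfolding sum_distrib_left
  proof (rule sum_mono)
    fix i
    have "(xm * g i) * (sm * \<bar>dxB i\<bar>) \<le> (XB i * g i) * (\<kappa> * P)"
      using xm that sm(1) XB by (intro mult_mono mult_right_mono dxB) (auto simp: less_imp_le)
    then show "xm * sm * (g i * \<bar>dxB i\<bar>) \<le> (\<kappa> * P) * (XB i * g i)" by (simp add: mult_ac)
  qed
  have stepN: "3 / 4 * (SN j * \<bar>dxN j\<bar>) \<le> \<bar>dN j\<bar> + xN j * \<bar>dsN j\<bar>" for j
  proof -
    have "3 / 4 * (SN j * \<bar>dxN j\<bar>) \<le> sN j * \<bar>dxN j\<bar>"
      using mult_right_mono[OF near(2), of "\<bar>dxN j\<bar>" j] by simp
    also have "\<dots> = \<bar>sN j * dxN j\<bar>"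
      using near(2)[of j] SN[of j] by (simp add: abs_mult)
    also have "sN j * dxN j = dN j - xN j * dsN j" using eqN[of j] by simp
    also have "\<bar>dN j - xN j * dsN j\<bar> \<le> \<bar>dN j\<bar> + \<bar>xN j * dsN j\<bar>" by (rule abs_triangle_ineq4)
    finally show ?thesis using pos(2)[of j] by (simp add: abs_mult)
  qed
  have stepB: "3 / 4 * (XB i * \<bar>dsB i\<bar>) \<le> \<bar>dB i\<bar> + sB i * \<bar>dxB i\<bar>" for i
  proof -
    have "3 / 4 * (XB i * \<bar>dsB i\<bar>) \<le> xB i * \<bar>dsB i\<bar>"
      using mult_right_mono[OF near(1), of "\<bar>dsB i\<bar>" i] by simp
    also have "\<dots> = \<bar>xB i * dsB i\<bar>"
      using near(1)[of i] XB[of i] by (simp add: abs_mult)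
    also have "xB i * dsB i = dB i - sB i * dxB i" using eqB[of i] by simp
    also have "\<bar>dB i - sB i * dxB i\<bar> \<le> \<bar>dB i\<bar> + \<bar>sB i * dxB i\<bar>" by (rule abs_triangle_ineq4)
    finally show ?thesis using pos(1)[of i] by (simp add: abs_mult)
  qed
  \<comment> \<open>Adding up the Newton equations: of the factor \<open>3/4\<close>, the coupling terms consume \<open>1/4\<close>.\<close>
  have "3 / 4 * P \<le> (\<Sum>j\<in>UNIV. \<bar>dN j\<bar>) + (\<Sum>j\<in>UNIV. xN j * \<bar>dsN j\<bar>)"
    unfolding P_def sum_distrib_left sum.distrib[symmetric] by (rule sum_mono) (rule stepN)
  moreover have "3 / 4 * Q \<le> (\<Sum>i\<in>UNIV. \<bar>dB i\<bar>) + (\<Sum>i\<in>UNIV. sB i * \<bar>dxB i\<bar>)"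
    unfolding Q_def sum_distrib_left sum.distrib[symmetric] by (rule sum_mono) (rule stepB)
  ultimately have "3 / 4 * (P + Q) \<le>
      D + ((\<Sum>j\<in>UNIV. xN j * \<bar>dsN j\<bar>) + (\<Sum>i\<in>UNIV. sB i * \<bar>dxB i\<bar>))"
    by (simp add: D_def)
  then have "xm * sm * (3 / 4 * (P + Q)) \<le> xm * sm *
      (D + ((\<Sum>j\<in>UNIV. xN j * \<bar>dsN j\<bar>) + (\<Sum>i\<in>UNIV. sB i * \<bar>dxB i\<bar>)))"
    using xm(1) sm(1) by (intro mult_left_mono) auto
  also have "\<dots> \<le> xm * sm * D + (\<kappa> * Q * X + \<kappa> * P * Y)"
    using crossN[of xN] crossB[of sB] pos
    by (simp add: distrib_left X_def Y_def less_imp_le add_mono)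
  also have "\<kappa> * Q * X + \<kappa> * P * Y \<le> \<kappa> * ((P + Q) * (X + Y))"
    using nn \<kappa>0 by (simp add: algebra_simps)
  also have "\<dots> \<le> \<kappa> * ((P + Q) * f)"
    using nn \<kappa>0 XY by (intro mult_left_mono) auto
  also have "\<dots> \<le> xm * sm * ((P + Q) / 4)"
    using mult_right_mono[OF small, of "(P + Q) / 16"] nn by (simp add: algebra_simps)
  finally have "(xm * sm) * (P + Q) \<le> (xm * sm) * (2 * D)"
    by (simp add: field_simps)
  then have PQ2: "P + Q \<le> 2 * D"
    using xm(1) sm(1) by (simp add: mult_le_cancel_left_pos)
  \<comment> \<open>The arithmetic-geometric mean inequality for \<open>P\<close> and \<open>Q\<close>.\<close>
  have "4 * (P * Q) \<le> (P + Q)\<^sup>2"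
    using zero_le_power2[of "P - Q"] by (simp add: power2_eq_square algebra_simps)
  also have "\<dots> \<le> (2 * D)\<^sup>2"
    using PQ2 nn by (intro power_mono) auto
  finally have PQ: "P * Q \<le> D\<^sup>2" by (simp add: power_mult_distrib)
  have "xm * sm * (\<Sum>i\<in>UNIV. \<bar>dxB i * dsB i\<bar>) \<le> \<kappa> * (P * Q)"
    using crossB[of "\<lambda>i. \<bar>dsB i\<bar>"] by (simp add: abs_mult Q_def mult_ac)
  also have "\<dots> \<le> \<kappa> * D\<^sup>2" using PQ \<kappa>0 by (rule mult_left_mono)
  finally show "xm * sm * (\<Sum>i\<in>UNIV. \<bar>dxB i * dsB i\<bar>) \<le> \<kappa> * D\<^sup>2" .
  have "xm * sm * (\<Sum>j\<in>UNIV. \<bar>dxN j * dsN j\<bar>) \<le> \<kappa> * (P * Q)"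
    using crossN[of "\<lambda>j. \<bar>dxN j\<bar>"] by (simp add: abs_mult P_def mult_ac)
  also have "\<dots> \<le> \<kappa> * D\<^sup>2" using PQ \<kappa>0 by (rule mult_left_mono)
  finally show "xm * sm * (\<Sum>j\<in>UNIV. \<bar>dxN j * dsN j\<bar>) \<le> \<kappa> * D\<^sup>2" .
qed

lemma difference_to_solution:
  assumes nd: "nondegenerate A b c xs" and feas: "(x, s, y) \<in> strictly_feasible A b c"
  shows "A *v (x - xs) = 0" and "(s - dual_s A c) + transpose A *v (y - dual_y A c) = 0"
proof -
  have "xs \<in> primal_solutions A b c" using nd by (simp add: nondegenerate_def)
  then have "A *v xs = b" by (simp add: primal_solutions_def primal_feasible_def)
  then show "A *v (x - xs) = 0"
    using feas by (simp add: strictly_feasible_def matrix_vector_mult_diff_distrib)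
  have "dual_s A c + transpose A *v dual_y A c = c"
    using nd by (intro dual_solution_equation) (simp add: nondegenerate_def)
  moreover have "s + transpose A *v y = c" using feas by (simp add: strictly_feasible_def)
  ultimately show "(s - dual_s A c) + transpose A *v (y - dual_y A c) = 0"
    by (simp add: matrix_vector_mult_diff_distrib algebra_simps del: transpose_matrix_vector)
qed

text \<open>The differences to the primal and the dual solution are orthogonal, and so are the two solutions
  themselves. Hence the gap \<open>\<langle>s, x\<rangle>\<close> bounds the coordinates \<open>x\<^sub>N\<close> and \<open>s\<^sub>B\<close> that vanish at the
  optimum.\<close>

lemma duality_gap_split:
  assumes nd: "nondegenerate A b c xs" and feas: "(x, s, y) \<in> strictly_feasible A b c"
  shows "(\<Sum>j\<in>UNIV. dual_s A c $ Inr j * x $ Inr j) + (\<Sum>i\<in>UNIV. xs $ Inl i * s $ Inl i) = s \<bullet> x"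
proof -
  have "(s - dual_s A c) \<bullet> (x - xs) = 0"
    using difference_to_solution[OF nd feas] by (rule kernel_orthogonal_range)
  then have "s \<bullet> x = s \<bullet> xs + dual_s A c \<bullet> x - dual_s A c \<bullet> xs"
    by (simp add: inner_diff)
  moreover have "dual_s A c \<bullet> xs = 0"
    using nd by (simp add: nondegenerate_def inner_vec_def sum_UNIV_Plus dual_s_def)
  moreover have "s \<bullet> xs = (\<Sum>i\<in>UNIV. xs $ Inl i * s $ Inl i)"
    using nd by (simp add: nondegenerate_def inner_vec_def sum_UNIV_Plus mult_ac)
  moreover have "dual_s A c \<bullet> x = (\<Sum>j\<in>UNIV. dual_s A c $ Inr j * x $ Inr j)"
    by (simp add: inner_vec_def sum_UNIV_Plus dual_s_def)
  ultimately show ?thesis by simp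
qed

lemma near_solution:
  assumes nd: "nondegenerate A b c xs" and feas: "(x, s, y) \<in> strictly_feasible A b c"
    and gap: "s \<bullet> x \<le> f" and small: "4 * kappa A * f \<le> pi_star A c xs"
  shows "3 / 4 * xs $ Inl i \<le> x $ Inl i" and "3 / 4 * dual_s A c $ Inr j \<le> s $ Inr j"
proof -
  note mins = pi_star_positive_bounds[OF nd]
  have inv: "invertible (basic_cols A)" using nd by (simp add: nondegenerate_def)
  have xpos: "0 < x $ i" and spos: "0 < s $ i" for i
    using feas by (auto simp: strictly_feasible_def)
  have \<kappa>0: "0 \<le> kappa A"
    using abs_basis_ratio_le_kappa order_trans abs_ge_zero by blast
  have 1: "s_min A c * (\<Sum>j\<in>UNIV. x $ Inr j) \<le> (\<Sum>j\<in>UNIV. dual_s A c $ Inr j * x $ Inr j)"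
    unfolding sum_distrib_left
    by (intro sum_mono mult_right_mono mins less_imp_le xpos)
  have 2: "x_min xs * (\<Sum>i\<in>UNIV. s $ Inl i) \<le> (\<Sum>i\<in>UNIV. xs $ Inl i * s $ Inl i)"
    unfolding sum_distrib_left
    by (intro sum_mono mult_right_mono mins less_imp_le spos)
  have n1: "0 \<le> (\<Sum>j\<in>UNIV. dual_s A c $ Inr j * x $ Inr j)"
    using mins xpos by (intro sum_nonneg mult_nonneg_nonneg) (auto intro: less_imp_le order_less_le_trans)
  have n2: "0 \<le> (\<Sum>i\<in>UNIV. xs $ Inl i * s $ Inl i)"
    using mins spos by (intro sum_nonneg mult_nonneg_nonneg) (auto intro: less_imp_le order_less_le_trans)
  have xN: "s_min A c * (\<Sum>j\<in>UNIV. x $ Inr j) \<le> f"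
    and sB: "x_min xs * (\<Sum>i\<in>UNIV. s $ Inl i) \<le> f"
    using 1 2 n1 n2 duality_gap_split[OF nd feas] gap by linarith+
  from kernel_basic_coordinate[OF inv difference_to_solution(1)[OF nd feas], of i]
  have "xs $ Inl i - x $ Inl i = (\<Sum>j\<in>UNIV. basis_ratio A $ i $ j * x $ Inr j)"
    using nd by (simp add: nondegenerate_def)
  also have "\<dots> \<le> (\<Sum>j\<in>UNIV. kappa A * x $ Inr j)"
    by (intro sum_mono mult_right_mono less_imp_le[OF xpos]
        order_trans[OF abs_ge_self abs_basis_ratio_le_kappa])
  finally have "s_min A c * (xs $ Inl i - x $ Inl i) \<le> kappa A * (s_min A c * (\<Sum>j\<in>UNIV. x $ Inr j))"
    using mins(2) by (simp add: sum_distrib_left[symmetric] mult.left_commute[of "kappa A"])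
  also have "\<dots> \<le> kappa A * f" using xN \<kappa>0 by (rule mult_left_mono)
  also have "\<dots> \<le> s_min A c * (x_min xs / 4)" using small by (simp add: pi_star_def mult_ac)
  finally have "xs $ Inl i - x $ Inl i \<le> x_min xs / 4" using mins(2) by (simp add: mult_le_cancel_left_pos)
  then show "3 / 4 * xs $ Inl i \<le> x $ Inl i" using mins(3)[of i] by simp
  from range_nonbasic_coordinate[OF inv difference_to_solution(2)[OF nd feas], of j]
  have "dual_s A c $ Inr j - s $ Inr j = (\<Sum>i\<in>UNIV. - basis_ratio A $ i $ j * s $ Inl i)"
    by (simp add: sum_negf dual_s_def)
  also have "\<dots> \<le> (\<Sum>i\<in>UNIV. kappa A * s $ Inl i)"
    by (intro sum_mono mult_right_mono less_imp_le[OF spos]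
        order_trans[OF abs_ge_minus_self abs_basis_ratio_le_kappa])
  finally have "x_min xs * (dual_s A c $ Inr j - s $ Inr j) \<le> kappa A * (x_min xs * (\<Sum>i\<in>UNIV. s $ Inl i))"
    using mins(1) by (simp add: sum_distrib_left[symmetric] mult.left_commute[of "kappa A"])
  also have "\<dots> \<le> kappa A * f" using sB \<kappa>0 by (rule mult_left_mono)
  also have "\<dots> \<le> x_min xs * (s_min A c / 4)" using small by (simp add: pi_star_def mult_ac)
  finally have "dual_s A c $ Inr j - s $ Inr j \<le> s_min A c / 4" using mins(1) by (simp add: mult_le_cancel_left_pos)
  then show "3 / 4 * dual_s A c $ Inr j \<le> s $ Inr j" using mins(4)[of j] by simp
qed

lemma newton_product_norm:
  assumes nd: "nondegenerate A b c xs" and feas: "(x, s, y) \<in> strictly_feasible A b c"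
    and gap: "s \<bullet> x \<le> f" and small: "4 * kappa A * f \<le> pi_star A c xs"
    and dir: "newton_direction A (x, s, y) d (dx, ds, dy)"
    and d: "(\<Sum>i\<in>UNIV. \<bar>d $ i\<bar>) \<le> D"
  shows "(pi_star A c xs)\<^sup>2 * (\<Sum>i\<in>UNIV. (dx $ i * ds $ i)\<^sup>2) \<le> 2 * (kappa A * D\<^sup>2)\<^sup>2"
proof -
  note mins = pi_star_positive_bounds[OF nd]
  have inv: "invertible (basic_cols A)" using nd by (simp add: nondegenerate_def)
  have \<kappa>0: "0 \<le> kappa A"
    using abs_basis_ratio_le_kappa order_trans abs_ge_zero by blast
  define D' where "D' = (\<Sum>i\<in>UNIV. \<bar>d $ Inl i\<bar>) + (\<Sum>j\<in>UNIV. \<bar>d $ Inr j\<bar>)"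
  define T where "T = (\<Sum>i\<in>UNIV. \<bar>dx $ Inl i * ds $ Inl i\<bar>)"
  define U where "U = (\<Sum>j\<in>UNIV. \<bar>dx $ Inr j * ds $ Inr j\<bar>)"
  have dir': "x $ i * ds $ i + s $ i * dx $ i = d $ i" "A *v dx = 0" "ds + transpose A *v dy = 0" for i
    using dir by (simp_all add: newton_direction_def)
  have pos: "0 < x $ i" "0 < s $ i" for i
    using feas by (auto simp: strictly_feasible_def)
  have gap': "(\<Sum>j\<in>UNIV. dual_s A c $ Inr j * x $ Inr j) + (\<Sum>i\<in>UNIV. xs $ Inl i * s $ Inl i) \<le> f"
    using duality_gap_split[OF nd feas] gap by simp
  note products = newton_products_bound[OF abs_basis_ratio_le_kappa mins(1,3) mins(2,4) pos(2) pos(1)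
      gap' small[unfolded pi_star_def] near_solution[OF nd feas gap small]
      kernel_basic_coordinate[OF inv dir'(2)] range_nonbasic_coordinate[OF inv dir'(3)] dir'(1) dir'(1),
      folded pi_star_def D'_def T_def U_def]
  have "kappa A * D'\<^sup>2 \<le> kappa A * D\<^sup>2"
    using d \<kappa>0 unfolding D'_def sum_UNIV_Plus
    by (intro mult_left_mono power_mono) (auto intro: add_nonneg_nonneg sum_nonneg)
  then have TU: "pi_star A c xs * T \<le> kappa A * D\<^sup>2" "pi_star A c xs * U \<le> kappa A * D\<^sup>2"
    using products by linarith+
  have \<pi>: "0 \<le> pi_star A c xs" using mins by (simp add: pi_star_def)
  have TU0: "0 \<le> T" "0 \<le> U" by (simp_all add: T_def U_def sum_nonneg)
  have sq: "(\<Sum>i\<in>UNIV. (g i)\<^sup>2) \<le> (\<Sum>i\<in>UNIV. \<bar>g i\<bar>)\<^sup>2" for g :: "'z::finite \<Rightarrow> real"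
    using L2_set_le_sum_abs[of g UNIV]
    by (metis L2_set_def L2_set_nonneg power_mono real_sqrt_pow2 sum_nonneg zero_le_power2)
  have "(\<Sum>i\<in>UNIV. (dx $ i * ds $ i)\<^sup>2) \<le> T\<^sup>2 + U\<^sup>2"
    unfolding sum_UNIV_Plus T_def U_def by (intro add_mono sq)
  then have "(pi_star A c xs)\<^sup>2 * (\<Sum>i\<in>UNIV. (dx $ i * ds $ i)\<^sup>2)
      \<le> (pi_star A c xs)\<^sup>2 * (T\<^sup>2 + U\<^sup>2)" by (rule mult_left_mono) simp
  also have "\<dots> = (pi_star A c xs * T)\<^sup>2 + (pi_star A c xs * U)\<^sup>2"
    by (simp add: power_mult_distrib distrib_left)
  also have "\<dots> \<le> (kappa A * D\<^sup>2)\<^sup>2 + (kappa A * D\<^sup>2)\<^sup>2"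
    using TU TU0 \<pi> by (intro add_mono power_mono) auto
  finally show ?thesis by simp
qed

section \<open>Proximity measures\<close>

text \<open>A form of the monotonicity of \<open>\<omega>\<^sub>*(\<tau>) / \<tau>\<^sup>2\<close>. The factor \<open>l\<close> may be negative, so that it
  also bounds \<open>\<omega>(\<tau>) = \<tau> - ln (1 + \<tau>) = \<omega>\<^sub>*(- \<tau>)\<close>. The derivatives of both sides in \<open>r\<close> are
  compared.\<close>

lemma omega_star_contraction:
  assumes "0 \<le> r" "r < 1" "\<bar>l\<bar> \<le> 1"
  shows "omega_star (l * r) \<le> l\<^sup>2 * omega_star r"
proof -
  define D where "D x = l\<^sup>2 * omega_star x - omega_star (l * x)" for x
  have lx: "l * x \<le> x" if "0 \<le> x" for x
    using mult_right_mono[of l 1 x] assms that by auto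
  have "D 0 \<le> D r"
  proof (rule DERIV_nonneg_imp_nondecreasing[OF assms(1)], intro exI conjI)
    fix x assume x: "0 \<le> x" "x \<le> r"
    then have pos: "0 < 1 - x" "0 < 1 - l * x" using lx[of x] assms by auto
    show "(D has_real_derivative l\<^sup>2 * (x / (1 - x)) - l * (l * x / (1 - l * x))) (at x)"
      unfolding D_def omega_star_def using pos
      by (auto intro!: derivative_eq_intros simp: field_simps)
    have "x / (1 - l * x) \<le> x / (1 - x)"
      using x pos lx[of x] by (intro divide_left_mono) auto
    then have "l\<^sup>2 * (x / (1 - l * x)) \<le> l\<^sup>2 * (x / (1 - x))"
      by (intro mult_left_mono) auto
    then show "0 \<le> l\<^sup>2 * (x / (1 - x)) - l * (l * x / (1 - l * x))"
      by (simp add: power2_eq_square mult_ac)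
  qed
  then show ?thesis by (simp add: D_def omega_star_def)
qed

lemma omega_star_pos:
  assumes "0 < r" "r < 1"
  shows "0 < omega_star r"
  using ln_le_minus_one[of "1 - r"] ln_eq_minus_one[of "1 - r"] assms
  by (fastforce simp: omega_star_def)

lemma norm_ge_of_omega_star_sum:
  fixes t :: "real^'a::finite"
  assumes r: "0 < r" "r < 1"
    and sum: "(\<Sum>j\<in>UNIV. omega_star (t $ j)) = omega_star r"
  shows "r \<le> norm t"
proof (rule ccontr)
  assume "\<not> r \<le> norm t"
  then have lt: "norm t < r" by simp
  have "omega_star (t $ j) \<le> (t $ j)\<^sup>2 * (omega_star r / r\<^sup>2)" for j
  proof -
    have "\<bar>t $ j / r\<bar> \<le> 1"
      using component_le_norm_cart[of t j] lt r by simp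
    from omega_star_contraction[OF _ r(2) this] r show ?thesis
      by (simp add: power_divide mult.commute)
  qed
  then have "omega_star r \<le> (\<Sum>j\<in>UNIV. (t $ j)\<^sup>2 * (omega_star r / r\<^sup>2))"
    unfolding sum[symmetric] by (rule sum_mono)
  also have "\<dots> = (norm t)\<^sup>2 * (omega_star r / r\<^sup>2)"
    by (simp only: norm_squared_eq_sum sum_distrib_right)
  also have "\<dots> < r\<^sup>2 * (omega_star r / r\<^sup>2)"
    using lt r omega_star_pos[OF r] by (intro mult_strict_right_mono power_strict_mono) auto
  finally show False using r by simp
qed

lemma controls_rho_pos:
  fixes w :: "'n::finite control"
  assumes "w \<in> controls"
  shows "0 < rho w"
  using assms by (auto simp: controls_def rho_def intro!: divide_pos_pos add_nonneg_pos)

lemma sum_resid: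
  fixes z :: "('n::finite, 'm::finite) pd_point \<times> 'n control"
  shows "(\<Sum>j\<in>UNIV. resid z $ j) = (real CARD('n) + 1) * rho (snd z)"
proof -
  obtain x s y v0 v where z: "z = ((x, s, y), (v0, v))" by (metis surj_pair)
  have "real CARD('n) + 1 \<noteq> 0" by (simp add: add_nonneg_eq_0_iff)
  then show ?thesis
    by (simp add: z resid_def sum_UNIV_option rho_def sum_subtractf norm_squared_eq_sum
        inner_vec_def mult.commute)
qed

text \<open>The deviations of the \<open>n + 1\<close> residuals from their mean \<open>\<rho>(w)\<close>. The measure \<open>\<chi>\<^sub>0(z)\<close>
  is their norm divided by \<open>\<rho>(w)\<close>.\<close>

definition deviation :: "('n::finite, 'm::finite) pd_point \<times> 'n control \<Rightarrow> real^('n option)" where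
  "deviation z = (\<chi> j. resid z $ j - rho (snd z))"

lemma sum_deviation: "(\<Sum>j\<in>UNIV. deviation z $ j) = 0"
  by (simp add: deviation_def sum_subtractf sum_resid card_option)

text \<open>As the deviations sum to zero, \<open>\<Psi>(z)\<close> is the sum of \<open>\<omega>\<^sub>*\<close> over the negated relative
  deviations.\<close>

lemma deviation_ge_of_proximity:
  assumes int: "z \<in> target_interior A b c" and r: "0 < r" "r < 1"
    and prox: "proximity z = omega_star r"
  shows "r * rho (snd z) \<le> norm (deviation z)"
proof -
  have res: "0 < resid z $ j" for j using int by (simp add: target_interior_def)
  have \<rho>: "0 < rho (snd z)"
    using int by (auto simp: target_interior_def target_region_def intro!: controls_rho_pos)
  define t where "t = - (inverse (rho (snd z))) *\<^sub>R deviation z"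
  have t: "omega_star (t $ j) = inverse (rho (snd z)) * deviation z $ j
      - (ln (resid z $ j) - ln (rho (snd z)))" for j
  proof -
    have "1 - t $ j = resid z $ j / rho (snd z)"
      using \<rho> by (simp add: t_def deviation_def field_simps)
    then show ?thesis
      using \<rho> res[of j] by (simp add: omega_star_def ln_div) (simp add: t_def)
  qed
  have "(\<Sum>j\<in>UNIV. omega_star (t $ j)) = proximity z"
    unfolding t sum_subtractf sum_distrib_left[symmetric] sum_deviation
    by (simp add: proximity_def barrier_def card_option algebra_simps)
  then have "r \<le> norm t" using norm_ge_of_omega_star_sum[OF r, of t] prox by simp
  also have "norm t = norm (deviation z) / rho (snd z)"
    using \<rho> by (simp add: t_def divide_inverse mult.commute)
  finally show ?thesis using \<rho> by (simp add: pos_le_divide_eq)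
qed

text \<open>That is, \<open>\<delta>(z) \<le> \<beta>\<close> implies \<open>\<chi>\<^sub>0(z) \<le> \<beta> / (1 - \<beta>)\<close>. With \<open>h\<close> the relative residuals
  \<open>r\<^sup>(\<^sup>j\<^sup>) / \<rho>\<close> and \<open>a = (h - 1) / h\<close>, the squares of \<open>\<chi>\<^sub>2\<close>, \<open>\<chi>\<^sub>1\<close>, \<open>\<chi>\<^sub>0\<close> are the sums of
  \<open>a\<^sup>2\<close>, \<open>a\<^sup>2 h\<close> and \<open>a\<^sup>2 h\<^sup>2\<close>. A first estimate \<open>\<chi>\<^sub>2 \<le> \<beta> / (1 - \<beta>)\<close> confines \<open>h\<close> to an interval
  \<open>[m, M]\<close>, on which the Cauchy-Schwarz inequality \<open>\<chi>\<^sub>1\<^sup>2 \<le> \<chi>\<^sub>0 \<chi>\<^sub>2\<close> can be reversed up to a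
  constant (Diaz-Metcalf): sum \<open>a\<^sup>2 (h - m) (M - h) \<ge> 0\<close>.\<close>

lemma deviation_le_of_delta:
  assumes res: "\<And>j. 0 < resid z $ j" and \<rho>: "0 < rho (snd z)"
    and \<beta>: "\<beta> \<le> 1 / 3" and delta: "delta_measure z \<le> \<beta>"
  shows "norm (deviation z) \<le> \<beta> / (1 - \<beta>) * rho (snd z)"
proof (cases "chi_measure 2 z = 0")
  case True
  have "(\<Sum>j\<in>UNIV. (resid z $ j - rho (snd z))\<^sup>2 / ((resid z $ j) ^ 2 * (rho (snd z)) ^ (2 - 2))) = 0"
    using True by (simp add: chi_measure_def)
  then have "\<forall>j. (resid z $ j - rho (snd z))\<^sup>2 / ((resid z $ j) ^ 2 * (rho (snd z)) ^ (2 - 2)) = 0"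
    by (subst (asm) sum_nonneg_eq_0_iff) auto
  then have "deviation z = 0"
    using res by (simp add: vec_eq_iff deviation_def) (metis less_irrefl)
  moreover have "0 \<le> \<beta>" using delta True by (simp add: delta_measure_def)
  ultimately show ?thesis using \<beta> \<rho> by simp
next
  case False
  define h where "h j = resid z $ j / rho (snd z)" for j
  define a :: "real^('a option)" where "a = (\<chi> j. (resid z $ j - rho (snd z)) / resid z $ j)"
  have h: "0 < h j" for j using res \<rho> by (simp add: h_def)
  have ah: "1 - a $ j = 1 / h j" for j
    using res[of j] by (simp add: a_def h_def field_simps)
  have chi2: "chi_measure 2 z = norm a"
  proof (rule power2_eq_imp_eq)
    show "(chi_measure 2 z)\<^sup>2 = (norm a)\<^sup>2"
      unfolding chi_measure_def norm_squared_eq_sum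
      by (subst real_sqrt_pow2) (auto simp: a_def power_divide intro!: sum_nonneg)
  qed (auto simp: chi_measure_def intro!: sum_nonneg)
  have chi1: "(chi_measure 1 z)\<^sup>2 = (\<Sum>j\<in>UNIV. (a $ j)\<^sup>2 * h j)"
  proof -
    have "(a $ j)\<^sup>2 * h j = (resid z $ j - rho (snd z))\<^sup>2 / ((resid z $ j) ^ 1 * (rho (snd z)) ^ (2 - 1))"
      for j
      using res[of j] by (simp add: a_def h_def power2_eq_square)
    moreover have "0 \<le> (\<Sum>j\<in>UNIV. (a $ j)\<^sup>2 * h j)"
      by (intro sum_nonneg mult_nonneg_nonneg less_imp_le[OF h]) auto
    ultimately show ?thesis by (simp add: chi_measure_def)
  qed
  have N: "0 < norm a" using False chi2 by simp
  have key: "(\<Sum>j\<in>UNIV. (a $ j)\<^sup>2 * h j) \<le> \<beta> * norm a"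
    using delta False N unfolding delta_measure_def chi1 chi2 by (simp add: pos_divide_le_eq)
  have up: "1 / h j \<le> 1 + norm a" and a_up: "a $ j \<le> norm a" for j
    using component_le_norm_cart[of a j] ah[of j] by linarith+
  have "(norm a)\<^sup>2 / (1 + norm a) = (\<Sum>j\<in>UNIV. (a $ j)\<^sup>2 * (1 / (1 + norm a)))"
    unfolding norm_squared_eq_sum by (simp add: sum_divide_distrib)
  also have "\<dots> \<le> (\<Sum>j\<in>UNIV. (a $ j)\<^sup>2 * h j)"
  proof (intro sum_mono mult_left_mono)
    fix j show "1 / (1 + norm a) \<le> h j"
      using up[of j] h[of j] pos_divide_le_eq[of "1 + norm a" 1 "h j"] N
      by (simp add: pos_divide_le_eq mult.commute add_pos_nonneg)
  qed simp
  finally have "(norm a)\<^sup>2 / (1 + norm a) \<le> \<beta> * norm a" using key by simp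
  then have "norm a * norm a \<le> norm a * (\<beta> * (1 + norm a))"
    using N by (simp add: power2_eq_square pos_divide_le_eq mult_ac)
  then have a1: "norm a \<le> \<beta> * (1 + norm a)" using N by simp
  have \<beta>0: "0 < \<beta>"
    using a1 N by (smt (verit) mult_nonpos_nonneg)
  \<comment> \<open>The bounds for \<open>h = 1 / (1 - a)\<close> that follow from \<open>\<bar>a\<bar> \<le> \<beta> / (1 - \<beta>)\<close>.\<close>
  define m M where "m = 1 - \<beta>" and "M = (1 - \<beta>) / (1 - 2 * \<beta>)"
  have hm: "m \<le> h j" and hM: "h j \<le> M" for j
  proof -
    have "1 / h j * (1 - \<beta>) \<le> (1 + norm a) * (1 - \<beta>)"
      using up \<beta> by (intro mult_right_mono) auto
    also have "\<dots> \<le> 1" using a1 by (simp add: algebra_simps)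
    finally show "m \<le> h j" using h[of j] by (simp add: m_def field_simps)
    have "(1 - 2 * \<beta>) \<le> (1 - norm a) * (1 - \<beta>)" using a1 by (simp add: algebra_simps)
    also have "\<dots> \<le> (1 / h j) * (1 - \<beta>)"
      using a_up[of j] ah[of j] \<beta> by (intro mult_right_mono) auto
    finally show "h j \<le> M" using h[of j] \<beta> by (simp add: M_def field_simps)
  qed
  have dev: "deviation z $ j = rho (snd z) * (a $ j * h j)" for j
    using \<rho> res[of j] by (simp add: deviation_def a_def h_def)
  define B where "B = (\<Sum>j\<in>UNIV. (a $ j * h j)\<^sup>2)"
  have "0 \<le> (\<Sum>j\<in>UNIV. (a $ j)\<^sup>2 * ((h j - m) * (M - h j)))"
    using hm hM by (intro sum_nonneg mult_nonneg_nonneg) auto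
  also have "\<dots> = (\<Sum>j\<in>UNIV. (m + M) * ((a $ j)\<^sup>2 * h j) - (a $ j * h j)\<^sup>2 - m * M * (a $ j)\<^sup>2)"
    by (intro sum.cong) (auto simp: power2_eq_square algebra_simps)
  also have "\<dots> = (m + M) * (\<Sum>j\<in>UNIV. (a $ j)\<^sup>2 * h j) - B - m * M * (norm a)\<^sup>2"
    by (simp add: sum_subtractf sum_distrib_left B_def norm_squared_eq_sum)
  also have "\<dots> \<le> (m + M) * (\<beta> * norm a) - B - m * M * (norm a)\<^sup>2"
    using \<beta> by (intro diff_right_mono mult_left_mono key) (auto simp: m_def M_def)
  finally have B1: "B \<le> (m + M) * \<beta> * norm a - m * M * (norm a)\<^sup>2" by simp
  have mM: "m + M = 2 * (1 - \<beta>)\<^sup>2 / (1 - 2 * \<beta>)" "m * M = (1 - \<beta>)\<^sup>2 / (1 - 2 * \<beta>)"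
    using \<beta> by (simp_all add: m_def M_def field_simps power2_eq_square)
  have "B \<le> (1 - \<beta>)\<^sup>2 / (1 - 2 * \<beta>) * (2 * \<beta> * norm a - (norm a)\<^sup>2)"
    using B1 unfolding mM by (simp add: algebra_simps diff_divide_distrib)
  also have "\<dots> \<le> (1 - \<beta>)\<^sup>2 / (1 - 2 * \<beta>) * \<beta>\<^sup>2"
  proof (intro mult_left_mono)
    show "2 * \<beta> * norm a - (norm a)\<^sup>2 \<le> \<beta>\<^sup>2"
      using zero_le_power2[of "\<beta> - norm a"] by (simp add: power2_eq_square algebra_simps)
  qed (use \<beta> in auto)
  also have "\<dots> \<le> (\<beta> / (1 - \<beta>))\<^sup>2"
  proof -
    \<comment> \<open>The only place where \<open>\<beta> \<le> 1/3\<close>, and not merely \<open>\<beta> < 1/2\<close>, is used.\<close>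
    have "\<beta> * (6 * \<beta> - 2) + \<beta> ^ 3 * (\<beta> - 4) \<le> 0"
      using \<beta> \<beta>0 by (intro add_nonpos_nonpos mult_nonneg_nonpos) auto
    moreover have "(1 - \<beta>)\<^sup>2 * (1 - \<beta>)\<^sup>2 =
        1 - 2 * \<beta> + (\<beta> * (6 * \<beta> - 2) + \<beta> ^ 3 * (\<beta> - 4))"
      by (simp add: power2_eq_square power3_eq_cube algebra_simps)
    ultimately have "(1 - \<beta>)\<^sup>2 * (1 - \<beta>)\<^sup>2 \<le> 1 - 2 * \<beta>" by linarith
    then have "(1 - \<beta>)\<^sup>2 / (1 - 2 * \<beta>) \<le> 1 / (1 - \<beta>)\<^sup>2"
      using \<beta> by (simp add: field_simps)
    from mult_right_mono[OF this, of "\<beta>\<^sup>2"] show ?thesis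
      by (simp add: power_divide)
  qed
  finally have "sqrt B \<le> \<beta> / (1 - \<beta>)"
    using \<beta> \<beta>0 by (intro real_le_lsqrt) (auto simp: B_def intro: sum_nonneg)
  moreover have "norm (deviation z) = rho (snd z) * sqrt B"
  proof (rule power2_eq_imp_eq)
    have "0 \<le> B" by (simp add: B_def sum_nonneg)
    then show "(norm (deviation z))\<^sup>2 = (rho (snd z) * sqrt B)\<^sup>2"
      unfolding norm_squared_eq_sum dev
      by (simp add: power_mult_distrib B_def sum_distrib_left)
  qed (use \<rho> in \<open>auto simp: B_def intro!: mult_nonneg_nonneg sum_nonneg\<close>)
  ultimately show ?thesis
    using \<rho> by (simp only: mult.commute[of "rho (snd z)"]) (simp only: mult_right_mono less_imp_le)
qed

section \<open>The predictor step\<close>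

text \<open>The coefficient of \<open>\<alpha>\<^sup>2\<close> in the deviations along the predictor direction.\<close>

definition predictor_curvature ::
    "real^'n \<Rightarrow> real^'n \<Rightarrow> real^'n::finite \<Rightarrow> real^('n option)" where
  "predictor_curvature dx ds v = (\<chi> j. (norm v)\<^sup>2 / (real CARD('n) + 1) +
     (case j of None \<Rightarrow> 0 | Some i \<Rightarrow> dx $ i * ds $ i - (v $ i)\<^sup>2))"

lemma rho_scaled:
  fixes w :: "'n::finite control"
  shows "rho ((1 - \<alpha>) *\<^sub>R w) = rho w + \<alpha> * ((norm (snd w))\<^sup>2 / (real CARD('n) + 1) - rho w)
      - \<alpha>\<^sup>2 * ((norm (snd w))\<^sup>2 / (real CARD('n) + 1))"
proof -
  define N where "N = real CARD('n) + 1"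
  define V where "V = (norm (snd w))\<^sup>2"
  have N: "N \<noteq> 0" by (simp add: N_def add_nonneg_eq_0_iff)
  have "rho ((1 - \<alpha>) *\<^sub>R w) = ((1 - \<alpha>) * fst w - (1 - \<alpha>)\<^sup>2 * V) / N"
    by (simp add: rho_def N_def V_def power_mult_distrib)
  also have "\<dots> = (fst w - V) / N + \<alpha> * (V / N - (fst w - V) / N) - \<alpha>\<^sup>2 * (V / N)"
    using N by (simp add: field_simps power2_eq_square)
  finally show ?thesis by (simp only: rho_def N_def V_def)
qed

lemma resid_components [simp]:
  "resid ((x, s, y), w) $ None = fst w - s \<bullet> x"
  "resid ((x, s, y), w) $ Some i = x $ i * s $ i - (snd w $ i)\<^sup>2"
  by (simp_all add: resid_def case_prod_unfold)

lemma predictor_deviation: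
  fixes w :: "'n::finite control"
  assumes dir: "newton_direction A (x, s, y) (predictor_rhs w) (dx, ds, dy)"
  shows "deviation ((x, s, y) + \<alpha> *\<^sub>R (dx, ds, dy), (1 - \<alpha>) *\<^sub>R w) =
    deviation ((x, s, y), w) + \<alpha>\<^sup>2 *\<^sub>R predictor_curvature dx ds (snd w)"
proof -
  define v0 v where "v0 = fst w" and "v = snd w"
  then have w: "fst w = v0" "snd w = v" by simp_all
  define q where "q = (norm v)\<^sup>2 / (real CARD('n) + 1)"
  have n1: "real CARD('n) + 1 \<noteq> 0" by (simp add: add_nonneg_eq_0_iff)
  have v0: "v0 = (real CARD('n) + 1) * (rho w + q)"
    using n1 by (simp add: w q_def rho_def add_divide_distrib[symmetric])
  have v2: "(norm v)\<^sup>2 = (real CARD('n) + 1) * q" using n1 by (simp add: q_def)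
  have lin: "x $ i * ds $ i + s $ i * dx $ i = q - rho w - 2 * (v $ i)\<^sup>2" for i
    using dir by (simp add: newton_direction_def predictor_rhs_def w q_def)
  have orth: "ds \<bullet> dx = 0"
    using dir kernel_orthogonal_range by (simp add: newton_direction_def) blast
  have cross: "s \<bullet> dx + ds \<bullet> x = real CARD('n) * (q - rho w) - 2 * (norm v)\<^sup>2"
  proof -
    have "s \<bullet> dx + ds \<bullet> x = (\<Sum>i\<in>UNIV. x $ i * ds $ i + s $ i * dx $ i)"
      by (simp add: inner_vec_def sum.distrib mult.commute)
    then show ?thesis
      by (simp add: lin sum_subtractf sum_distrib_left[symmetric] norm_squared_eq_sum)
  qed
  have \<rho>: "rho ((1 - \<alpha>) *\<^sub>R w) = rho w + \<alpha> * (q - rho w) - \<alpha>\<^sup>2 * q"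
    using rho_scaled[of \<alpha> w] by (simp add: q_def w)
  have "deviation ((x, s, y) + \<alpha> *\<^sub>R (dx, ds, dy), (1 - \<alpha>) *\<^sub>R w) $ j =
    (deviation ((x, s, y), w) + \<alpha>\<^sup>2 *\<^sub>R predictor_curvature dx ds (snd w)) $ j" for j
  proof (cases j)
    case None
    have inner: "(s + \<alpha> *\<^sub>R ds) \<bullet> (x + \<alpha> *\<^sub>R dx) = s \<bullet> x + \<alpha> * (s \<bullet> dx + ds \<bullet> x)"
      by (simp add: inner_add_left inner_add_right orth algebra_simps)
    have curv: "predictor_curvature dx ds v $ None = q"
      by (simp add: predictor_curvature_def w q_def)
    have "(1 - \<alpha>) * v0 - (s \<bullet> x + \<alpha> * (real CARD('n) * (q - rho w) - 2 * ((real CARD('n) + 1) * q)))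
        - (rho w + \<alpha> * (q - rho w) - \<alpha>\<^sup>2 * q) = v0 - s \<bullet> x - rho w + \<alpha>\<^sup>2 * q"
      unfolding v0 by (simp add: algebra_simps)
    then show ?thesis
      unfolding None by (simp add: deviation_def curv inner cross v2 \<rho> w)
  next
    case (Some i)
    have prod: "(x $ i + \<alpha> * dx $ i) * (s $ i + \<alpha> * ds $ i) = x $ i * s $ i
        + \<alpha> * (x $ i * ds $ i + s $ i * dx $ i) + \<alpha>\<^sup>2 * (dx $ i * ds $ i)"
      by (simp add: power2_eq_square algebra_simps)
    have curv: "predictor_curvature dx ds v $ Some i = q + (dx $ i * ds $ i - (v $ i)\<^sup>2)"
      by (simp add: predictor_curvature_def w q_def)
    show ?thesis
      unfolding Some
      by (simp add: deviation_def curv prod lin \<rho> w) (simp add: power2_eq_square algebra_simps)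
  qed
  then show ?thesis by (simp add: vec_eq_iff)
qed

lemma norm_predictor_curvature:
  fixes dx ds v :: "real^'n::finite"
  assumes "(\<Sum>i\<in>UNIV. (dx $ i * ds $ i)\<^sup>2) \<le> E\<^sup>2" and "0 \<le> E"
  shows "norm (predictor_curvature dx ds v) \<le> E + (norm v)\<^sup>2"
proof -
  define q where "q = (norm v)\<^sup>2 / (real CARD('n) + 1)"
  define P :: "real^('n option)" where
    "P = (\<chi> j. case j of None \<Rightarrow> 0 | Some i \<Rightarrow> dx $ i * ds $ i)"
  define R :: "real^('n option)" where
    "R = (\<chi> j. q - (case j of None \<Rightarrow> 0 | Some i \<Rightarrow> (v $ i)\<^sup>2))"
  have n1: "real CARD('n) + 1 \<noteq> 0" by (simp add: add_nonneg_eq_0_iff)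
  have "predictor_curvature dx ds v = P + R"
    by (auto simp: predictor_curvature_def P_def R_def q_def vec_eq_iff split: option.split)
  moreover have "norm P \<le> E"
  proof (rule power2_le_imp_le)
    show "(norm P)\<^sup>2 \<le> E\<^sup>2"
      using assms(1) by (simp add: norm_squared_eq_sum sum_UNIV_option P_def)
  qed (rule assms(2))
  moreover have "norm R \<le> (norm v)\<^sup>2"
  proof (rule power2_le_imp_le)
    have v2: "(\<Sum>i\<in>UNIV. (v $ i)\<^sup>2) = (real CARD('n) + 1) * q"
      using n1 by (simp add: q_def norm_squared_eq_sum)
    have "(norm R)\<^sup>2 = q\<^sup>2 + (\<Sum>i\<in>UNIV. (q - (v $ i)\<^sup>2)\<^sup>2)"
      by (subst norm_squared_eq_sum) (simp add: sum_UNIV_option R_def)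
    also have "\<dots> = (real CARD('n) + 1) * q\<^sup>2 - 2 * q * (\<Sum>i\<in>UNIV. (v $ i)\<^sup>2)
        + (\<Sum>i\<in>UNIV. ((v $ i)\<^sup>2)\<^sup>2)"
      by (simp add: power2_diff sum.distrib sum_subtractf sum_distrib_left algebra_simps)
    also have "\<dots> \<le> (\<Sum>i\<in>UNIV. ((v $ i)\<^sup>2)\<^sup>2)"
      unfolding v2 using zero_le_power2[of q] mult_nonneg_nonneg[of "real CARD('n)" "q\<^sup>2"]
      by (simp add: power2_eq_square algebra_simps)
    also have "\<dots> \<le> (\<Sum>i\<in>UNIV. (v $ i)\<^sup>2 * (norm v)\<^sup>2)"
    proof (rule sum_mono)
      fix i
      have "(v $ i)\<^sup>2 \<le> (norm v)\<^sup>2"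
        using power_mono[OF component_le_norm_cart abs_ge_zero, of v i 2] by simp
      then show "((v $ i)\<^sup>2)\<^sup>2 \<le> (v $ i)\<^sup>2 * (norm v)\<^sup>2"
        unfolding power2_eq_square[of "(v $ i)\<^sup>2"] by (intro mult_left_mono) auto
    qed
    also have "\<dots> = ((norm v)\<^sup>2)\<^sup>2"
      unfolding sum_distrib_right[symmetric] norm_squared_eq_sum[symmetric]
      by (simp add: power2_eq_square)
    finally show "(norm R)\<^sup>2 \<le> ((norm v)\<^sup>2)\<^sup>2" .
  qed simp
  ultimately show ?thesis using norm_triangle_ineq[of P R] by simp
qed

lemma sum_abs_predictor_rhs:
  assumes "w \<in> controls"
  shows "(\<Sum>i\<in>UNIV. \<bar>predictor_rhs w $ i\<bar>) \<le> 3 * fst w"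
proof -
  obtain v0 v where w: "w = (v0, v :: real^'a)" by (cases w)
  let ?n = "real CARD('a)"
  have n1: "0 < ?n + 1" by (simp add: add_nonneg_pos)
  have c: "0 \<le> v0" "(norm v)\<^sup>2 < v0" using assms by (auto simp: w controls_def)
  have "\<bar>predictor_rhs w $ i\<bar> \<le> v0 / (?n + 1) + 2 * (v $ i)\<^sup>2" for i
  proof -
    have "0 \<le> (norm v)\<^sup>2 / (?n + 1)" "0 \<le> rho w" "(norm v)\<^sup>2 / (?n + 1) + rho w = v0 / (?n + 1)"
      using n1 controls_rho_pos[OF assms] by (simp_all add: w rho_def add_divide_distrib[symmetric])
    then have "\<bar>(norm v)\<^sup>2 / (?n + 1) - rho w - 2 * (v $ i)\<^sup>2\<bar> \<le> v0 / (?n + 1) + 2 * (v $ i)\<^sup>2"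
      by (smt (verit) zero_le_power2)
    then show ?thesis by (simp add: predictor_rhs_def w)
  qed
  then have "(\<Sum>i\<in>UNIV. \<bar>predictor_rhs w $ i\<bar>) \<le> (\<Sum>i\<in>UNIV. v0 / (?n + 1) + 2 * (v $ i)\<^sup>2)"
    by (rule sum_mono)
  also have "\<dots> = ?n * v0 / (?n + 1) + 2 * (norm v)\<^sup>2"
    by (simp add: sum.distrib sum_distrib_left norm_squared_eq_sum)
  also have "?n * v0 / (?n + 1) \<le> v0"
    using n1 c by (simp add: pos_divide_le_eq algebra_simps)
  finally show ?thesis using c by (simp add: w)
qed

text \<open>In a run, \<open>f0\<close> is the initial value of the first control variable, and \<open>v\<close> holds because the
  controls are multiples of the initial one.\<close>

lemma predictor_step_decrease:
  fixes A :: "real^('m::finite + 'k::finite)^'m" and z z' :: "('m + 'k, 'm) pd_point \<times> ('m + 'k) control"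
  assumes nd: "nondegenerate A b c xs"
    and step: "predictor_step A b c r z z'" and int: "z \<in> target_interior A b c"
    and r: "0 < r" "r < 1" and \<beta>: "\<beta> \<le> 1 / 3" and delta: "delta_measure z \<le> \<beta>"
    and small: "4 * kappa A * f0 \<le> pi_star A c xs"
    and lt: "fst (snd z) < f0" and v: "(norm (snd (snd z)))\<^sup>2 \<le> (fst (snd z))\<^sup>2 / f0"
  shows "fst (snd z') \<le> (1 / r) * (\<beta> / (1 - \<beta>)
    + 5 * (real CARD('m + 'k) + 1) * fst (snd z) / (f0 - fst (snd z))) * fst (snd z)"
proof -
  obtain x s y w where z: "z = ((x, s, y), w)" by (metis surj_pair)
  define f where "f = fst w"
  let ?n = "real CARD('m + 'k)"
  have n1: "0 < ?n + 1" by (simp add: add_nonneg_pos)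
  have feas: "(x, s, y) \<in> strictly_feasible A b c" and w: "w \<in> controls"
    and res: "\<And>j. 0 < resid z $ j"
    using int by (auto simp: z target_interior_def target_region_def)
  have \<rho>: "0 < rho w" using w by (rule controls_rho_pos)
  have f: "0 < f" "f < f0"
    using w lt by (auto simp: f_def z controls_def intro: le_less_trans[OF zero_le_power2])
  have gap: "s \<bullet> x \<le> f"
    using res[of None] by (simp add: z resid_def f_def case_prod_unfold)
  have v2: "(norm (snd w))\<^sup>2 \<le> f\<^sup>2 / f0" using v by (simp add: z f_def)
  obtain \<alpha> D where dir0: "newton_direction A (x, s, y) (predictor_rhs w) D"
    and \<alpha>: "0 < \<alpha>" "\<alpha> < 1" and z': "z' = ((x, s, y) + \<alpha> *\<^sub>R D, (1 - \<alpha>) *\<^sub>R w)"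
    and int': "z' \<in> target_interior A b c" and prox: "proximity z' = omega_star r"
    using step by (auto simp: predictor_step_def z)
  obtain dx ds dy where D: "D = (dx, ds, dy)" by (metis surj_pair)
  note dir = dir0[unfolded D]
  define g where "g = predictor_curvature dx ds (snd w)"
  have \<kappa>0: "0 \<le> kappa A"
    using abs_basis_ratio_le_kappa order_trans abs_ge_zero by blast
  have \<pi>: "0 < pi_star A c xs" using pi_star_positive_bounds[OF nd] by (simp add: pi_star_def)
  have "4 * kappa A * f \<le> 4 * kappa A * f0"
    using f \<kappa>0 by (intro mult_left_mono) auto
  then have small': "4 * kappa A * f \<le> pi_star A c xs" using small by linarith
  have sq: "(pi_star A c xs)\<^sup>2 * (\<Sum>i\<in>UNIV. (dx $ i * ds $ i)\<^sup>2) \<le> 2 * (kappa A * (3 * f)\<^sup>2)\<^sup>2"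
    using sum_abs_predictor_rhs[OF w]
    by (intro newton_product_norm[OF nd feas gap small' dir]) (simp add: f_def)
  have prods: "(\<Sum>i\<in>UNIV. (dx $ i * ds $ i)\<^sup>2) \<le> (4 * (f\<^sup>2 / f0))\<^sup>2"
  proof -
    \<comment> \<open>With \<open>3\<^sup>2\<close> from \<open>\<parallel>d\<parallel>\<^sub>1 \<le> 3 f\<close> and \<open>1/4\<close> from \<open>small\<close>, the constant is \<open>2 (9/4)\<^sup>2 = 81/8 \<le> 4\<^sup>2\<close>.\<close>
    have "kappa A * (3 * f)\<^sup>2 = 4 * kappa A * f0 * (9 / 4 * (f\<^sup>2 / f0))"
      using f by (simp add: power_mult_distrib)
    also have "\<dots> \<le> pi_star A c xs * (9 / 4 * (f\<^sup>2 / f0))"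
      using f by (intro mult_right_mono small) auto
    finally have "(kappa A * (3 * f)\<^sup>2)\<^sup>2 \<le> (pi_star A c xs * (9 / 4 * (f\<^sup>2 / f0)))\<^sup>2"
      using \<kappa>0 by (intro power_mono) auto
    also have "2 * \<dots> \<le> (pi_star A c xs)\<^sup>2 * (4 * (f\<^sup>2 / f0))\<^sup>2"
    proof -
      have "2 * (p * (9 / 4 * e))\<^sup>2 \<le> p\<^sup>2 * (4 * e)\<^sup>2" for p e :: real
        using zero_le_power2[of "p * e"] by (simp add: power2_eq_square algebra_simps)
      then show ?thesis .
    qed
    finally have "(pi_star A c xs)\<^sup>2 * (\<Sum>i\<in>UNIV. (dx $ i * ds $ i)\<^sup>2)
        \<le> (pi_star A c xs)\<^sup>2 * (4 * (f\<^sup>2 / f0))\<^sup>2"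
      using sq by linarith
    then show ?thesis using \<pi> by (simp add: mult_le_cancel_left_pos)
  qed
  have g: "norm g \<le> 5 * (f\<^sup>2 / f0)"
    using norm_predictor_curvature[OF prods, of "snd w"] v2 f by (simp add: g_def)
  have "(?n + 1) * rho w = f - (norm (snd w))\<^sup>2"
    unfolding rho_def f_def times_divide_eq_right
    using n1 by (intro nonzero_mult_div_cancel_left) linarith
  moreover have "f * (f0 - f) / f0 = f - f\<^sup>2 / f0"
    using f by (simp add: field_simps power2_eq_square)
  ultimately have "f * (f0 - f) / f0 \<le> (?n + 1) * rho w"
    using v2 by linarith
  then have \<rho>_ge: "f * (f0 - f) \<le> f0 * (?n + 1) * rho w"
    using f by (simp add: pos_divide_le_eq mult_ac)
  have g\<rho>: "norm g \<le> 5 * (?n + 1) * f / (f0 - f) * rho w"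
  proof -
    have "5 * (f\<^sup>2 / f0) = 5 * f / (f0 * (f0 - f)) * (f * (f0 - f))"
      using f by (simp add: field_simps power2_eq_square)
    also have "\<dots> \<le> 5 * f / (f0 * (f0 - f)) * (f0 * (?n + 1) * rho w)"
      using f by (intro mult_left_mono \<rho>_ge) auto
    also have "\<dots> = 5 * (?n + 1) * f / (f0 - f) * rho w"
      using f by (simp add: field_simps)
    finally show ?thesis using g by linarith
  qed
  have dev: "norm (deviation z) \<le> \<beta> / (1 - \<beta>) * rho w"
    using deviation_le_of_delta[OF res _ \<beta> delta] \<rho> by (simp add: z)
  have "(1 - \<alpha>) * rho w \<le> rho ((1 - \<alpha>) *\<^sub>R w)"
  proof -
    have "0 \<le> (\<alpha> - \<alpha>\<^sup>2) * ((norm (snd w))\<^sup>2 / (?n + 1))"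
      using \<alpha> n1 by (intro mult_nonneg_nonneg) (auto simp: power2_eq_square mult_le_cancel_left1)
    then show ?thesis unfolding rho_scaled by (simp add: algebra_simps diff_divide_distrib)
  qed
  then have "r * ((1 - \<alpha>) * rho w) \<le> r * rho (snd z')"
    using r by (simp add: z')
  also have "\<dots> \<le> norm (deviation z')" by (rule deviation_ge_of_proximity[OF int' r prox])
  also have "deviation z' = deviation z + \<alpha>\<^sup>2 *\<^sub>R g"
    unfolding z' D z g_def by (rule predictor_deviation[OF dir])
  also have "norm \<dots> \<le> norm (deviation z) + \<alpha>\<^sup>2 * norm g"
    using norm_triangle_ineq[of "deviation z" "\<alpha>\<^sup>2 *\<^sub>R g"] by simp
  also have "\<alpha>\<^sup>2 * norm g \<le> 1 * norm g"
    using \<alpha> by (intro mult_right_mono) (auto simp: power_le_one)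
  finally have "r * ((1 - \<alpha>) * rho w)
      \<le> \<beta> / (1 - \<beta>) * rho w + 5 * (?n + 1) * f / (f0 - f) * rho w"
    using dev g\<rho> by linarith
  then have "r * (1 - \<alpha>) * rho w
      \<le> (\<beta> / (1 - \<beta>) + 5 * (?n + 1) * f / (f0 - f)) * rho w"
    by (simp only: distrib_right mult.assoc)
  then have "r * (1 - \<alpha>) \<le> \<beta> / (1 - \<beta>) + 5 * (?n + 1) * f / (f0 - f)"
    using \<rho> by (simp add: mult_le_cancel_right_pos)
  then have "1 - \<alpha> \<le> (1 / r) * (\<beta> / (1 - \<beta>) + 5 * (?n + 1) * f / (f0 - f))"
    using r by (simp add: pos_le_divide_eq mult.commute)
  then have "(1 - \<alpha>) * f \<le> (1 / r) * (\<beta> / (1 - \<beta>) + 5 * (?n + 1) * f / (f0 - f)) * f"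
    using f by (intro mult_right_mono) auto
  then show ?thesis by (simp add: z' z f_def)
qed

section \<open>Runs of the method\<close>

text \<open>All residuals of the initial point are equal to \<open>\<sigma>\<close>.\<close>

lemma initial_point_interior:
  fixes u :: "('n::finite, 'm::finite) pd_point"
  assumes u: "u \<in> strictly_feasible A b c"
  shows "(u, initial_control u) \<in> target_interior A b c"
proof -
  obtain x s y where u': "u = (x, s, y)" by (metis surj_pair)
  define \<sigma> where "\<sigma> = Min (range (\<lambda>i. x $ i * s $ i))"
  have pos: "0 < x $ i" "0 < s $ i" for i using u by (auto simp: u' strictly_feasible_def)
  have \<sigma>: "0 < \<sigma>" "\<sigma> \<le> x $ i * s $ i" for i using pos by (auto simp: \<sigma>_def)
  define v :: "real^'n" where "v = (\<chi> i. sqrt (x $ i * s $ i - \<sigma>))"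
  have ic: "initial_control u = (s \<bullet> x + \<sigma>, v)"
    by (simp add: initial_control_def u' \<sigma>_def v_def Let_def)
  have vi: "(v $ i)\<^sup>2 = x $ i * s $ i - \<sigma>" for i using \<sigma>(2)[of i] by (simp add: v_def)
  have "(norm v)\<^sup>2 = s \<bullet> x - real CARD('n) * \<sigma>"
    by (simp add: norm_squared_eq_sum vi sum_subtractf inner_vec_def mult.commute)
  moreover have "0 \<le> real CARD('n) * \<sigma>" using \<sigma>(1) by simp
  ultimately have less: "(norm v)\<^sup>2 < s \<bullet> x + \<sigma>" using \<sigma>(1) by linarith
  then have "0 \<le> s \<bullet> x + \<sigma>" using zero_le_power2[of "norm v"] by linarith
  then have "initial_control u \<in> controls" using less by (simp add: ic controls_def)
  moreover have "0 < resid (u, initial_control u) $ j" for j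
    by (cases j) (simp_all add: ic[unfolded u'] u' vi \<sigma>(1))
  ultimately show ?thesis
    using u by (auto simp: target_interior_def target_region_def less_imp_le)
qed

lemma run_invariant:
  assumes run: "TPTFM_run A b c r \<epsilon> \<beta> \<eta> z" and "\<And>j. j < k \<Longrightarrow> performed \<epsilon> \<beta> z j"
  shows "z k \<in> target_interior A b c \<and> (\<exists>t. snd (z k) = t *\<^sub>R snd (z 0))"
  using assms(2)
proof (induction k)
  case 0
  have "z 0 = (fst (z 0), initial_control (fst (z 0)))"
    using run by (simp add: TPTFM_run_def prod_eq_iff)
  then have "z 0 \<in> target_interior A b c"
    using run initial_point_interior[of "fst (z 0)" A b c] by (simp add: TPTFM_run_def)
  then show ?case by (metis scaleR_one)
next
  case (Suc k)
  then obtain t where IH: "z k \<in> target_interior A b c" "snd (z k) = t *\<^sub>R snd (z 0)"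
    by (metis less_SucI)
  have "predictor_step A b c r (z k) (z (Suc k)) \<or> corrector_step A b c (\<eta> k) (z k) (z (Suc k))"
    using run Suc.prems[of k] by (auto simp: TPTFM_run_def split: if_splits)
  then show ?case
  proof
    assume "predictor_step A b c r (z k) (z (Suc k))"
    then obtain \<alpha> where "snd (z (Suc k)) = (1 - \<alpha>) *\<^sub>R snd (z k)" "z (Suc k) \<in> target_interior A b c"
      unfolding predictor_step_def by (metis snd_conv)
    then show ?thesis using IH by (metis scaleR_scaleR)
  next
    assume "corrector_step A b c (\<eta> k) (z k) (z (Suc k))"
    then have "snd (z (Suc k)) = snd (z k)" "z (Suc k) \<in> target_interior A b c"
      unfolding corrector_step_def by (metis snd_conv)+
    then show ?thesis using IH by metis
  qed
qed

theorem theorem2: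
  fixes A :: "real^('m::finite + 'k::finite)^'m"
    and b :: "real^'m"
    and c xs :: "real^('m + 'k)"
    and r \<epsilon> :: real
    and \<beta> \<eta> f :: "nat \<Rightarrow> real"
    and z :: "nat \<Rightarrow> ('m + 'k, 'm) pd_point \<times> ('m + 'k) control"
  assumes "strictly_feasible A b c \<noteq> {}"
    and "nondegenerate A b c xs"
    and "TPTFM_run A b c r \<epsilon> \<beta> \<eta> z"
    and "\<And>k. f k = fst (snd (z k))"
    and "kappa A > 0 \<longrightarrow> f 0 \<le> pi_star A c xs / (4 * kappa A)"
  shows "\<forall>k. performed \<epsilon> \<beta> z k \<and> delta_measure (z k) \<le> \<beta> k \<and> f k < f 0 \<longrightarrow>
           f (Suc k) \<le> (1 / r) *
             (\<beta> k / (1 - \<beta> k) + 5 * (real CARD('m + 'k) + 1) * f k / (f 0 - f k)) * f k"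
proof (intro allI impI)
  fix k assume k: "performed \<epsilon> \<beta> z k \<and> delta_measure (z k) \<le> \<beta> k \<and> f k < f 0"
  note run = assms(3) and nd = assms(2)
  have r: "0 < r" "r < 1" using run by (simp_all add: TPTFM_run_def)
  have "\<beta> k < r / (2 + r)" using run by (simp add: TPTFM_run_def)
  also have "\<dots> \<le> 1 / 3" using r by (simp add: field_simps)
  finally have \<beta>: "\<beta> k \<le> 1 / 3" by simp
  have step: "predictor_step A b c r (z k) (z (Suc k))"
    using run k by (simp add: TPTFM_run_def)
  have performed: "performed \<epsilon> \<beta> z j" if "j < k" for j
    using k that by (simp add: performed_def)
  obtain t where int: "z k \<in> target_interior A b c" and t: "snd (z k) = t *\<^sub>R snd (z 0)"
    using run_invariant[OF run, of k] performed by blast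
  have "z 0 \<in> target_interior A b c" using run_invariant[OF run, of 0] by simp
  then have "(norm (snd (snd (z 0))))\<^sup>2 < f 0"
    unfolding assms(4) by (auto simp: target_interior_def target_region_def controls_def)
  moreover from this have f0: "0 < f 0" by (rule le_less_trans[OF zero_le_power2])
  ultimately have "t\<^sup>2 * (norm (snd (snd (z 0))))\<^sup>2 \<le> t\<^sup>2 * f 0"
    by (intro mult_left_mono) auto
  moreover have "f k = t * f 0" using t by (simp add: assms(4))
  moreover from this have "(f k)\<^sup>2 / f 0 = t\<^sup>2 * f 0" using f0 by (simp add: power2_eq_square)
  ultimately have v: "(norm (snd (snd (z k))))\<^sup>2 \<le> (fst (snd (z k)))\<^sup>2 / f 0"
    unfolding assms(4)[symmetric] by (simp add: t power_mult_distrib)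
  have "0 \<le> kappa A" using abs_basis_ratio_le_kappa order_trans abs_ge_zero by blast
  moreover have "0 \<le> pi_star A c xs"
    using pi_star_positive_bounds[OF nd] by (simp add: pi_star_def)
  ultimately have small: "4 * kappa A * f 0 \<le> pi_star A c xs"
    using assms(5) by (cases "kappa A = 0") (auto simp: pos_le_divide_eq mult_ac)
  show "f (Suc k) \<le> (1 / r) *
      (\<beta> k / (1 - \<beta> k) + 5 * (real CARD('m + 'k) + 1) * f k / (f 0 - f k)) * f k"
    using predictor_step_decrease[OF nd step int r \<beta> _ small _ v] k unfolding assms(4) by simp
qed

end
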